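(* Assume $8\mathrm{e}p\Delta^3\le 0.99p'$. Let $1\le t\le n$ and let $\ell$ be the length of the random path $\mathsf{Path}(X^t_0)=(X^t_0,X^t_1,\dots,X^t_\ell)$ generated as described in the context. Then for every integer $i\ge 0$, \[\Pr\left[\ell\ge ik\Delta^2\right]\le\Delta\cdot 2^{-i}.\]
   Context: CSP formula $\Phi=(V,\mathcal{Q},\mathcal{C})$: finite variable set $V=\{v_1,\dots,v_n\}$ (with this fixed ordering); finite domains $Q_v$, $q_v=|Q_v|\ge2$; constraints $c\in\mathcal{C}$ with scope $\mathsf{vbl}(c)$ and $c:\bigotimes_{u\in\mathsf{vbl}(c)}Q_u\to\{\mathtt{True},\mathtt{False}\}$. $q=\max q_v$, $k=\max|\mathsf{vbl}(c)|$, $\Delta=\max_c|\{c':\mathsf{vbl}(c)\cap\mathsf{vbl}(c')\ne\emptyset\}|$ (counting $c$); $\mathbb{P}$ uniform product distribution; $p=\max_c\mathbb{P}[\neg c]$. Partial assignments $\sigma\in\bigotimes_v(Q_v\cup\{\star,\circ\})$ ($\star$ accessed unassigned, $\circ$ unaccessed); $\Lambda(\sigma)=\{v:\sigma(v)\in Q_v\}$, $\Lambda^+(\sigma)=\{v:\sigma(v)\ne\circ\}$; $\sigma_{u\gets x}$ replaces the value at $u$ by $x$; $\mathbb{P}[A\mid\sigma]$ conditions on agreement on $\Lambda(\sigma)$; $\sigma$ satisfies $c$ if all extensions do; $\mu_u^\sigma$ is the marginal at $u$ of the uniform distribution on satisfying assignments of $\Phi$ conditioned on agreeing with $\sigma$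 on $\Lambda(\sigma)$. Parameters: $p'=(18\mathrm{e}^2q^2k\Delta^4)^{-1}$, $\eta=(1-\mathrm{e}p'q)^{-\Delta}-1$, $\zeta=(8\mathrm{e}qk\Delta^3)^{-1}$, $\theta_u=1/q_u-\eta-\zeta$. Frozen/fixed: fix an oracle which on $(c,\sigma)$ answers "yes" if $\mathbb{P}[\neg c\mid\sigma]>p'$, "no" if $<0.99p'$, otherwise arbitrarily but consistently (depending only on $c$ and $\sigma|_{\mathsf{vbl}(c)}$). $\mathcal{C}^\sigma_{\mathsf{frozen}}$ = set of $c$ with answer "yes"; $u$ is $\sigma$-fixed if $u\in V^\sigma_{\mathsf{fix}}=\Lambda^+(\sigma)\cup\bigcup_{c\in\mathcal{C}^\sigma_{\mathsf{frozen}}}\mathsf{vbl}(c)$. Structures: $V^\sigma=V\setminus\Lambda(\sigma)$; $H^\sigma$ hypergraph on $V^\sigma$ with, for each $c$ not satisfied by $\sigma$, hyperedge $\mathsf{vbl}(c)\setminus\Lambda(\sigma)$; $H^\sigma_{\mathsf{fix}}$ sub-hypergraph on $V^\sigma\cap V^\sigma_{\mathsf{fix}}$ with hyperedges contained in it; $V^\sigma_\star$ the vertices of components of $H^\sigma_{\mathsf{fix}}$ containing some $v$ with $\sigma(v)=\star$; $V^\sigma_\partial=\{u\in V^\sigma\setminus V^\sigma_\star:$ some hyperedge of $H^\sigma$ contains $u$ and a vertex of $V^\sigma_\star\}$; $\mathsf{var}(\sigma)$ the element of $V^\sigma_\partial$ of smallest index, or $\perp$ if empty. $\mathsf{Path}(\sigma)=(\sigma_0,\dots,\sigma_\ell)$: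 $\sigma_0=\sigma$; for $i=0,1,\dots$, if $\mathsf{var}(\sigma_i)=\perp$ stop; else with $u=\mathsf{var}(\sigma_i)$, $\sigma_{i+1}=(\sigma_i)_{u\gets\star}$ w.p. $\frac{1-q_u\theta_u}{2-q_u\theta_u}$ and $\sigma_{i+1}=(\sigma_i)_{u\gets x}$ w.p. $\frac{\mu_u^{\sigma_i}(x)}{2-q_u\theta_u}$ for $x\in Q_u$. Process: $(X^0,\dots,X^{t-1})$ is generated by $X^0=\circ^V$ and for $i=1,\dots,t-1$: if $v_i$ is $X^{i-1}$-fixed then $X^i=X^{i-1}$; otherwise $X^i=X^{i-1}_{v_i\gets b}$ with $b$ drawn from $\mu^{X^{i-1}}_{v_i}$. Then $X^t_0=X^{t-1}$ if $v_t$ is $X^{t-1}$-fixed and $X^t_0=X^{t-1}_{v_t\gets\star}$ otherwise, and $(X^t_0,\dots,X^t_\ell)=\mathsf{Path}(X^t_0)$. *)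

theory Defs
  imports "HOL-Probability.Probability"
begin

section \<open>CSP formulas\<close>

text \<open>
  The variables are \<open>nth_var \<Phi> 1, \<dots>, nth_var \<Phi> (num_vars \<Phi>)\<close>, in this order.  A constraint \<open>c\<close> is
  a Boolean function on \<open>PiE (vbl \<Phi> c) (Dom \<Phi>)\<close>; only these values of \<open>holds \<Phi> c\<close> are ever used.
\<close>

record ('v, 'a, 'c) csp =
  num_vars :: nat
  nth_var :: "nat \<Rightarrow> 'v"
  Dom :: "'v \<Rightarrow> 'a set"
  constraints :: "'c set"
  vbl :: "'c \<Rightarrow> 'v set"
  holds :: "'c \<Rightarrow> ('v \<Rightarrow> 'a) \<Rightarrow> bool"

definition vars :: "('v, 'a, 'c) csp \<Rightarrow> 'v set" where
  "vars \<Phi> = nth_var \<Phi> ` {1..num_vars \<Phi>}"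

text \<open>
  Nonemptiness of the set of constraints makes the maxima below meaningful; nonemptiness of the
  scopes is what makes every \<open>c\<close> one of the constraints counted in its own degree.
\<close>

definition csp_formula :: "('v, 'a, 'c) csp \<Rightarrow> bool" where
  "csp_formula \<Phi> \<longleftrightarrow>
     inj_on (nth_var \<Phi>) {1..num_vars \<Phi>} \<and>
     (\<forall>u\<in>vars \<Phi>. finite (Dom \<Phi> u) \<and> card (Dom \<Phi> u) \<ge> 2) \<and>
     finite (constraints \<Phi>) \<and> constraints \<Phi> \<noteq> {} \<and>
     (\<forall>c\<in>constraints \<Phi>. vbl \<Phi> c \<subseteq> vars \<Phi> \<and> vbl \<Phi> c \<noteq> {})"

definition assignments :: "('v, 'a, 'c) csp \<Rightarrow> ('v \<Rightarrow> 'a) set" where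
  "assignments \<Phi> = PiE (vars \<Phi>) (Dom \<Phi>)"

definition sat :: "('v, 'a, 'c) csp \<Rightarrow> 'c \<Rightarrow> ('v \<Rightarrow> 'a) \<Rightarrow> bool" where
  "sat \<Phi> c \<tau> \<longleftrightarrow> holds \<Phi> c (restrict \<tau> (vbl \<Phi> c))"

definition solutions :: "('v, 'a, 'c) csp \<Rightarrow> ('v \<Rightarrow> 'a) set" where
  "solutions \<Phi> = {\<tau> \<in> assignments \<Phi>. \<forall>c\<in>constraints \<Phi>. sat \<Phi> c \<tau>}"

definition product_pmf :: "('v, 'a, 'c) csp \<Rightarrow> ('v \<Rightarrow> 'a) pmf" where
  "product_pmf \<Phi> = Pi_pmf (vars \<Phi>) undefined (\<lambda>u. pmf_of_set (Dom \<Phi> u))"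

definition dom_size :: "('v, 'a, 'c) csp \<Rightarrow> 'v \<Rightarrow> nat" where
  "dom_size \<Phi> u = card (Dom \<Phi> u)"

definition max_dom :: "('v, 'a, 'c) csp \<Rightarrow> nat" where
  "max_dom \<Phi> = Max (dom_size \<Phi> ` vars \<Phi>)"

definition csp_width :: "('v, 'a, 'c) csp \<Rightarrow> nat" where
  "csp_width \<Phi> = Max ((\<lambda>c. card (vbl \<Phi> c)) ` constraints \<Phi>)"

definition csp_degree :: "('v, 'a, 'c) csp \<Rightarrow> nat" where
  "csp_degree \<Phi> =
     Max ((\<lambda>c. card {c' \<in> constraints \<Phi>. vbl \<Phi> c \<inter> vbl \<Phi> c' \<noteq> {}}) ` constraints \<Phi>)"

definition viol_prob :: "('v, 'a, 'c) csp \<Rightarrow> real" where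
  "viol_prob \<Phi> =
     Max ((\<lambda>c. measure_pmf.prob (product_pmf \<Phi>) {\<tau>. \<not> sat \<Phi> c \<tau>}) ` constraints \<Phi>)"

section \<open>Parameters\<close>

definition p_thr :: "('v, 'a, 'c) csp \<Rightarrow> real" where
  "p_thr \<Phi> = 1 / (18 * (exp 1)\<^sup>2 * real (max_dom \<Phi>) ^ 2 * real (csp_width \<Phi>) * real (csp_degree \<Phi>) ^ 4)"

definition eta :: "('v, 'a, 'c) csp \<Rightarrow> real" where
  "eta \<Phi> = (1 - exp 1 * p_thr \<Phi> * real (max_dom \<Phi>)) powi (- int (csp_degree \<Phi>)) - 1"

definition zeta :: "('v, 'a, 'c) csp \<Rightarrow> real" where
  "zeta \<Phi> = 1 / (8 * exp 1 * real (max_dom \<Phi>) * real (csp_width \<Phi>) * real (csp_degree \<Phi>) ^ 3)"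

definition theta :: "('v, 'a, 'c) csp \<Rightarrow> 'v \<Rightarrow> real" where
  "theta \<Phi> u = 1 / real (dom_size \<Phi> u) - eta \<Phi> - zeta \<Phi>"

section \<open>Partial assignments\<close>

text \<open>\<open>Star\<close> marks an accessed but unassigned variable, \<open>Unacc\<close> an unaccessed one.\<close>

datatype 'a pval = Val 'a | Star | Unacc

definition partial_assignments :: "('v, 'a, 'c) csp \<Rightarrow> ('v \<Rightarrow> 'a pval) set" where
  "partial_assignments \<Phi> = {\<sigma>. \<forall>u\<in>vars \<Phi>. \<sigma> u \<in> Val ` Dom \<Phi> u \<union> {Star, Unacc}}"

definition assigned :: "('v, 'a, 'c) csp \<Rightarrow> ('v \<Rightarrow> 'a pval) \<Rightarrow> 'v set" where
  "assigned \<Phi> \<sigma> = {u \<in> vars \<Phi>. \<sigma> u \<in> range Val}"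

definition accessed :: "('v, 'a, 'c) csp \<Rightarrow> ('v \<Rightarrow> 'a pval) \<Rightarrow> 'v set" where
  "accessed \<Phi> \<sigma> = {u \<in> vars \<Phi>. \<sigma> u \<noteq> Unacc}"

definition agrees :: "('v, 'a, 'c) csp \<Rightarrow> ('v \<Rightarrow> 'a pval) \<Rightarrow> ('v \<Rightarrow> 'a) \<Rightarrow> bool" where
  "agrees \<Phi> \<sigma> \<tau> \<longleftrightarrow> (\<forall>u\<in>assigned \<Phi> \<sigma>. \<sigma> u = Val (\<tau> u))"

definition viol_prob_given :: "('v, 'a, 'c) csp \<Rightarrow> 'c \<Rightarrow> ('v \<Rightarrow> 'a pval) \<Rightarrow> real" where
  "viol_prob_given \<Phi> c \<sigma> = cond_prob (product_pmf \<Phi>) (\<lambda>\<tau>. \<not> sat \<Phi> c \<tau>) (agrees \<Phi> \<sigma>)"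

definition satisfied_by :: "('v, 'a, 'c) csp \<Rightarrow> 'c \<Rightarrow> ('v \<Rightarrow> 'a pval) \<Rightarrow> bool" where
  "satisfied_by \<Phi> c \<sigma> \<longleftrightarrow> (\<forall>\<tau>\<in>assignments \<Phi>. agrees \<Phi> \<sigma> \<tau> \<longrightarrow> sat \<Phi> c \<tau>)"

text \<open>The following is meaningful when some solution agrees with \<open>\<sigma>\<close>.\<close>

definition marginal :: "('v, 'a, 'c) csp \<Rightarrow> ('v \<Rightarrow> 'a pval) \<Rightarrow> 'v \<Rightarrow> 'a pmf" where
  "marginal \<Phi> \<sigma> u =
     map_pmf (\<lambda>\<tau>. \<tau> u) (cond_pmf (pmf_of_set (solutions \<Phi>)) {\<tau>. agrees \<Phi> \<sigma> \<tau>})"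

section \<open>Frozen constraints and fixed variables\<close>

text \<open>\<open>orc c \<sigma>\<close> is the answer ``yes'' on the query \<open>(c, \<sigma>)\<close>.\<close>

definition frozen_oracle ::
  "('v, 'a, 'c) csp \<Rightarrow> ('c \<Rightarrow> ('v \<Rightarrow> 'a pval) \<Rightarrow> bool) \<Rightarrow> bool" where
  "frozen_oracle \<Phi> orc \<longleftrightarrow>
     (\<forall>c\<in>constraints \<Phi>. \<forall>\<sigma>\<in>partial_assignments \<Phi>.
        (viol_prob_given \<Phi> c \<sigma> > p_thr \<Phi> \<longrightarrow> orc c \<sigma>) \<and>
        (viol_prob_given \<Phi> c \<sigma> < 0.99 * p_thr \<Phi> \<longrightarrow> \<not> orc c \<sigma>)) \<and>
     (\<forall>c\<in>constraints \<Phi>. \<forall>\<sigma>\<in>partial_assignments \<Phi>. \<forall>\<sigma>'\<in>partial_assignments \<Phi>.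
        (\<forall>u\<in>vbl \<Phi> c. \<sigma> u = \<sigma>' u) \<longrightarrow> orc c \<sigma> = orc c \<sigma>')"

definition frozen ::
  "('v, 'a, 'c) csp \<Rightarrow> ('c \<Rightarrow> ('v \<Rightarrow> 'a pval) \<Rightarrow> bool) \<Rightarrow> ('v \<Rightarrow> 'a pval) \<Rightarrow> 'c set" where
  "frozen \<Phi> orc \<sigma> = {c \<in> constraints \<Phi>. orc c \<sigma>}"

definition V_fix ::
  "('v, 'a, 'c) csp \<Rightarrow> ('c \<Rightarrow> ('v \<Rightarrow> 'a pval) \<Rightarrow> bool) \<Rightarrow> ('v \<Rightarrow> 'a pval) \<Rightarrow> 'v set" where
  "V_fix \<Phi> orc \<sigma> = accessed \<Phi> \<sigma> \<union> (\<Union>c\<in>frozen \<Phi> orc \<sigma>. vbl \<Phi> c)"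

section \<open>The hypergraphs and the next variable\<close>

definition hyper_components :: "'v set \<Rightarrow> 'v set set \<Rightarrow> 'v set set" where
  "hyper_components W E =
     W // {(x, y) \<in> W \<times> W. (x, y) \<in> {(a, b). \<exists>e\<in>E. a \<in> e \<and> b \<in> e}\<^sup>*}"

definition V_un :: "('v, 'a, 'c) csp \<Rightarrow> ('v \<Rightarrow> 'a pval) \<Rightarrow> 'v set" where
  "V_un \<Phi> \<sigma> = vars \<Phi> - assigned \<Phi> \<sigma>"

definition hyperedges :: "('v, 'a, 'c) csp \<Rightarrow> ('v \<Rightarrow> 'a pval) \<Rightarrow> 'v set set" where
  "hyperedges \<Phi> \<sigma> =
     {vbl \<Phi> c - assigned \<Phi> \<sigma> | c. c \<in> constraints \<Phi> \<and> \<not> satisfied_by \<Phi> c \<sigma>}"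

definition V_star ::
  "('v, 'a, 'c) csp \<Rightarrow> ('c \<Rightarrow> ('v \<Rightarrow> 'a pval) \<Rightarrow> bool) \<Rightarrow> ('v \<Rightarrow> 'a pval) \<Rightarrow> 'v set" where
  "V_star \<Phi> orc \<sigma> =
     (let W = V_un \<Phi> \<sigma> \<inter> V_fix \<Phi> orc \<sigma>
      in \<Union>{K \<in> hyper_components W {e \<in> hyperedges \<Phi> \<sigma>. e \<subseteq> W}. \<exists>u\<in>K. \<sigma> u = Star})"

definition V_bd ::
  "('v, 'a, 'c) csp \<Rightarrow> ('c \<Rightarrow> ('v \<Rightarrow> 'a pval) \<Rightarrow> bool) \<Rightarrow> ('v \<Rightarrow> 'a pval) \<Rightarrow> 'v set" where
  "V_bd \<Phi> orc \<sigma> =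
     {u \<in> V_un \<Phi> \<sigma> - V_star \<Phi> orc \<sigma>. \<exists>e\<in>hyperedges \<Phi> \<sigma>. u \<in> e \<and> e \<inter> V_star \<Phi> orc \<sigma> \<noteq> {}}"

definition next_var ::
  "('v, 'a, 'c) csp \<Rightarrow> ('c \<Rightarrow> ('v \<Rightarrow> 'a pval) \<Rightarrow> bool) \<Rightarrow> ('v \<Rightarrow> 'a pval) \<Rightarrow> 'v option" where
  "next_var \<Phi> orc \<sigma> =
     (if V_bd \<Phi> orc \<sigma> = {} then None
      else Some (nth_var \<Phi> (LEAST i. i \<in> {1..num_vars \<Phi>} \<and> nth_var \<Phi> i \<in> V_bd \<Phi> orc \<sigma>)))"

lemma next_var_SomeD:
  assumes "next_var \<Phi> orc \<sigma> = Some u"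
  shows "u \<in> vars \<Phi>" "u \<in> V_bd \<Phi> orc \<sigma>" "\<sigma> u = Unacc"
proof -
  let ?P = "\<lambda>i. i \<in> {1..num_vars \<Phi>} \<and> nth_var \<Phi> i \<in> V_bd \<Phi> orc \<sigma>"
  have ne: "V_bd \<Phi> orc \<sigma> \<noteq> {}" and u: "u = nth_var \<Phi> (LEAST i. ?P i)"
    using assms by (auto simp: next_var_def split: if_splits)
  have "V_bd \<Phi> orc \<sigma> \<subseteq> nth_var \<Phi> ` {1..num_vars \<Phi>}"
    by (auto simp: V_bd_def V_un_def vars_def)
  with ne have "\<exists>i. ?P i" by blast
  then have P: "?P (LEAST i. ?P i)" by (rule LeastI_ex)
  show uV: "u \<in> vars \<Phi>" unfolding u vars_def by (rule imageI) (use P in blast)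
  show bd: "u \<in> V_bd \<Phi> orc \<sigma>" unfolding u using P by blast
  have un: "u \<in> V_un \<Phi> \<sigma>" and nst: "u \<notin> V_star \<Phi> orc \<sigma>"
    using bd by (auto simp: V_bd_def)
  have "\<sigma> u \<noteq> Star"
  proof
    assume st: "\<sigma> u = Star"
    let ?W = "V_un \<Phi> \<sigma> \<inter> V_fix \<Phi> orc \<sigma>"
    let ?R = "{(x, y) \<in> ?W \<times> ?W. (x, y) \<in> {(a, b). \<exists>e\<in>{e \<in> hyperedges \<Phi> \<sigma>. e \<subseteq> ?W}. a \<in> e \<and> b \<in> e}\<^sup>*}"
    have uW: "u \<in> ?W" using un uV st by (auto simp: V_fix_def accessed_def)
    then have "?R `` {u} \<in> ?W // ?R" by (rule quotientI)
    moreover have "u \<in> ?R `` {u}" using uW by auto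
    ultimately have "u \<in> V_star \<Phi> orc \<sigma>"
      unfolding V_star_def hyper_components_def Let_def using st by blast
    with nst show False ..
  qed
  moreover have "\<sigma> u \<notin> range Val" using un uV by (auto simp: V_un_def assigned_def)
  ultimately show "\<sigma> u = Unacc" by (cases "\<sigma> u") auto
qed

section \<open>The random path\<close>

text \<open>
  The new value of \<open>u\<close>: with probability \<open>(1 - q\<^sub>u \<theta>\<^sub>u) / (2 - q\<^sub>u \<theta>\<^sub>u)\<close> it is \<open>Star\<close>, and otherwise
  it is drawn from the marginal, so that \<open>x\<close> gets probability \<open>\<mu>(x) / (2 - q\<^sub>u \<theta>\<^sub>u)\<close>; see
  \<open>pmf_step_value\<close>.
\<close>

definition step_value :: "('v, 'a, 'c) csp \<Rightarrow> ('v \<Rightarrow> 'a pval) \<Rightarrow> 'v \<Rightarrow> 'a pval pmf" where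
  "step_value \<Phi> \<sigma> u =
     (let r = real (dom_size \<Phi> u) * theta \<Phi> u in
      bernoulli_pmf ((1 - r) / (2 - r)) \<bind>
        (\<lambda>b. if b then return_pmf Star else map_pmf Val (marginal \<Phi> \<sigma> u)))"

lemma Unacc_notin_step_value: "Unacc \<notin> set_pmf (step_value \<Phi> \<sigma> u)"
  by (auto simp: step_value_def Let_def split: if_splits)

lemma dom_size_theta_le_1:
  assumes "csp_formula \<Phi>" "u \<in> vars \<Phi>"
  shows "real (dom_size \<Phi> u) * theta \<Phi> u \<le> 1"
proof -
  let ?q = "real (max_dom \<Phi>)" and ?k = "real (csp_width \<Phi>)" and ?D = "real (csp_degree \<Phi>)"
  have fin: "finite (vars \<Phi>)" "finite (constraints \<Phi>)" and ne: "constraints \<Phi> \<noteq> {}"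
    using assms by (auto simp: vars_def csp_formula_def)
  obtain c where c: "c \<in> constraints \<Phi>" using ne by blast
  have du: "2 \<le> dom_size \<Phi> u" using assms by (auto simp: csp_formula_def dom_size_def)
  also have "\<dots> \<le> max_dom \<Phi>" unfolding max_dom_def using fin assms(2) by (intro Max_ge) auto
  finally have q: "?q \<ge> 1" by simp
  have vc: "vbl \<Phi> c \<noteq> {}" "finite (vbl \<Phi> c)"
    using assms c finite_subset[OF _ fin(1)] by (auto simp: csp_formula_def)
  have "1 \<le> card (vbl \<Phi> c)" using vc by (simp add: Suc_leI card_gt_0_iff)
  also have "\<dots> \<le> csp_width \<Phi>" unfolding csp_width_def using fin c by (intro Max_ge) auto
  finally have k: "?k \<ge> 1" by simp
  have "c \<in> {c' \<in> constraints \<Phi>. vbl \<Phi> c \<inter> vbl \<Phi> c' \<noteq> {}}" using c vc by auto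
  then have "1 \<le> card {c' \<in> constraints \<Phi>. vbl \<Phi> c \<inter> vbl \<Phi> c' \<noteq> {}}"
    using fin by (subst One_nat_def, intro Suc_leI, subst card_gt_0_iff) auto
  also have "\<dots> \<le> csp_degree \<Phi>" unfolding csp_degree_def using fin c by (intro Max_ge) auto
  finally have D: "?D \<ge> 1" by simp
  have z: "zeta \<Phi> \<ge> 0" by (simp add: zeta_def)
  have e: "exp 1 \<ge> (1::real)" by simp
  have "1 \<le> exp 1 * ?q * ?k * ?D ^ 4"
    using e q k D by (metis mult_ge1_I one_le_power)
  then have "1 < 18 * (exp 1 * ?q * ?k * ?D ^ 4)" by linarith
  moreover have "exp 1 * p_thr \<Phi> * ?q = 1 / (18 * (exp 1 * ?q * ?k * ?D ^ 4))"
    using q by (simp add: p_thr_def power2_eq_square)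
  ultimately have x: "0 \<le> exp 1 * p_thr \<Phi> * ?q" "exp 1 * p_thr \<Phi> * ?q < 1"
    by simp_all
  have "eta \<Phi> \<ge> 0"
    using x by (simp add: eta_def power_int_minus one_le_inverse_iff power_le_one)
  with z have "theta \<Phi> u \<le> 1 / real (dom_size \<Phi> u)" by (simp add: theta_def)
  with du show ?thesis by (simp add: field_simps)
qed

lemma pmf_step_value:
  assumes "csp_formula \<Phi>" "u \<in> vars \<Phi>"
  shows "pmf (step_value \<Phi> \<sigma> u) Star =
           (1 - real (dom_size \<Phi> u) * theta \<Phi> u) / (2 - real (dom_size \<Phi> u) * theta \<Phi> u)"
    and "pmf (step_value \<Phi> \<sigma> u) (Val x) =
           pmf (marginal \<Phi> \<sigma> u) x / (2 - real (dom_size \<Phi> u) * theta \<Phi> u)"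
proof -
  define r where "r = real (dom_size \<Phi> u) * theta \<Phi> u"
  have r: "r \<le> 1" unfolding r_def by (rule dom_size_theta_le_1[OF assms])
  then have r': "0 \<le> (1 - r) / (2 - r)" "(1 - r) / (2 - r) \<le> 1" by simp_all
  have "pmf (map_pmf Val (marginal \<Phi> \<sigma> u)) Star = 0"
    by (intro pmf_map_outside) auto
  then show "pmf (step_value \<Phi> \<sigma> u) Star =
      (1 - real (dom_size \<Phi> u) * theta \<Phi> u) / (2 - real (dom_size \<Phi> u) * theta \<Phi> u)"
    using r' by (simp add: step_value_def Let_def pmf_bind flip: r_def)
  have "pmf (map_pmf Val (marginal \<Phi> \<sigma> u)) (Val x) = pmf (marginal \<Phi> \<sigma> u) x"
    by (intro pmf_map_inj') (simp add: inj_def)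
  moreover have "1 - (1 - r) / (2 - r) = 1 / (2 - r)" using r by (simp add: field_simps)
  ultimately show "pmf (step_value \<Phi> \<sigma> u) (Val x) =
      pmf (marginal \<Phi> \<sigma> u) x / (2 - real (dom_size \<Phi> u) * theta \<Phi> u)"
    using r' by (simp add: step_value_def Let_def pmf_bind flip: r_def)
qed

function Path ::
  "('v, 'a, 'c) csp \<Rightarrow> ('c \<Rightarrow> ('v \<Rightarrow> 'a pval) \<Rightarrow> bool) \<Rightarrow> ('v \<Rightarrow> 'a pval) \<Rightarrow> ('v \<Rightarrow> 'a pval) list pmf"
where
  "Path \<Phi> orc \<sigma> =
     (case next_var \<Phi> orc \<sigma> of
        None \<Rightarrow> return_pmf [\<sigma>]
      | Some u \<Rightarrow> step_value \<Phi> \<sigma> u \<bind> (\<lambda>y. map_pmf (Cons \<sigma>) (Path \<Phi> orc (\<sigma>(u := y)))))"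
  by pat_completeness auto
termination
proof (relation "Wellfounded.measure (\<lambda>(\<Phi>, orc, \<sigma>). card {u \<in> vars \<Phi>. \<sigma> u = Unacc})", goal_cases)
  case (2 \<Phi> orc \<sigma> u y)
  then have y: "y \<noteq> Unacc" using Unacc_notin_step_value by metis
  have fin: "finite {w \<in> vars \<Phi>. \<sigma> w = Unacc}" by (simp add: vars_def)
  have u: "u \<in> vars \<Phi>" "\<sigma> u = Unacc" using next_var_SomeD[OF 2(1)] by auto
  have "{w \<in> vars \<Phi>. (\<sigma>(u := y)) w = Unacc} \<subset> {w \<in> vars \<Phi>. \<sigma> w = Unacc}"
    using u y by auto
  from psubset_card_mono[OF fin this] show ?case by simp
qed simp

declare Path.simps [simp del]

text \<open>The length of \<open>(\<sigma>\<^sub>0, \<dots>, \<sigma>\<^sub>l)\<close> is \<open>l\<close>, one less than the number of its entries.\<close>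

definition path_length :: "'b list \<Rightarrow> nat" where
  "path_length xs = length xs - 1"

section \<open>The process\<close>

text \<open>\<open>X_pmf \<Phi> orc i\<close> is the law of \<open>X\<^sup>i\<close>.\<close>

fun X_pmf ::
  "('v, 'a, 'c) csp \<Rightarrow> ('c \<Rightarrow> ('v \<Rightarrow> 'a pval) \<Rightarrow> bool) \<Rightarrow> nat \<Rightarrow> ('v \<Rightarrow> 'a pval) pmf" where
  "X_pmf \<Phi> orc 0 = return_pmf (\<lambda>_. Unacc)"
| "X_pmf \<Phi> orc (Suc i) =
     X_pmf \<Phi> orc i \<bind> (\<lambda>\<sigma>.
       let u = nth_var \<Phi> (Suc i) in
       if u \<in> V_fix \<Phi> orc \<sigma> then return_pmf \<sigma>
       else map_pmf (\<lambda>b. \<sigma>(u := Val b)) (marginal \<Phi> \<sigma> u))"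

definition path_start ::
  "('v, 'a, 'c) csp \<Rightarrow> ('c \<Rightarrow> ('v \<Rightarrow> 'a pval) \<Rightarrow> bool) \<Rightarrow> nat \<Rightarrow> ('v \<Rightarrow> 'a pval) \<Rightarrow> ('v \<Rightarrow> 'a pval)" where
  "path_start \<Phi> orc t \<sigma> =
     (if nth_var \<Phi> t \<in> V_fix \<Phi> orc \<sigma> then \<sigma> else \<sigma>(nth_var \<Phi> t := Star))"

text \<open>The law of \<open>(X\<^sup>t\<^sub>0, \<dots>, X\<^sup>t\<^sub>l)\<close>, for \<open>t \<ge> 1\<close>.\<close>

definition X_path ::
  "('v, 'a, 'c) csp \<Rightarrow> ('c \<Rightarrow> ('v \<Rightarrow> 'a pval) \<Rightarrow> bool) \<Rightarrow> nat \<Rightarrow> ('v \<Rightarrow> 'a pval) list pmf" where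
  "X_path \<Phi> orc t = X_pmf \<Phi> orc (t - 1) \<bind> (\<lambda>\<sigma>. Path \<Phi> orc (path_start \<Phi> orc t \<sigma>))"

end

theory Submission
  imports Defs
begin

text \<open>
  Call a constraint bad in \<open>\<sigma>\<close> if it is frozen or contains a \<open>Star\<close>.  In a path of length at least
  \<open>i k \<Delta>\<^sup>2\<close> started from a single \<open>Star\<close> at \<open>v\<close>, more than \<open>i \<Delta>\<close> constraints are bad at some moment
  while meeting \<open>V_star\<close>; in the dependency graph these are linked to the constraints containing \<open>v\<close>
  by steps of length at most two.  A greedy choice gives pairwise disjoint bad constraints
  \<open>r, c\<^sub>1, \<dots>, c\<^sub>i\<close> with \<open>v\<close> in \<open>r\<close>, linked by steps of length at most three, and there are at most
  \<open>\<Delta> (4 \<Delta>\<^sup>3)\<^sup>i\<close> such families.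

  It remains to bound by \<open>(8 \<Delta>\<^sup>3)\<^sup>-\<^sup>i\<close> the probability that disjoint constraints \<open>c\<^sub>1, \<dots>, c\<^sub>i\<close> avoiding \<open>v\<close> all
  become bad.  Multiplying probabilities by the number of solutions agreeing with \<open>\<sigma>\<close> turns the
  draws from the marginals into plain sums over values.  If the constraints that meet \<open>c\<^sub>1, \<dots>, c\<^sub>i\<close> are
  then dropped from the solution count, the variables of \<open>c\<^sub>1, \<dots>, c\<^sub>i\<close> are uniform and independent
  whatever the adaptive order of revelation, so that the product of the supermartingales \<open>pot\<close>
  applies.  By the local lemma, dropping these constraints costs a factor of at most
  \<open>(1 - 2p\<Delta>)\<^sup>-\<^sup>i\<close>.
\<close>

section \<open>Mixtures and conditioning of discrete distributions\<close>

text \<open>The nonnegative integral of a mixture splits without side conditions. The bounds on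
  \<open>F\<close> make every integral finite, so the identity passes to real expectations whatever
  the support.\<close>

lemma expectation_bind_pmf:
  fixes F :: "'b \<Rightarrow> real" and f :: "'c \<Rightarrow> 'b pmf"
  assumes F: "\<And>x. 0 \<le> F x" "\<And>x. F x \<le> 1"
  shows "measure_pmf.expectation (bind_pmf M f) F =
           measure_pmf.expectation M (\<lambda>x. measure_pmf.expectation (f x) F)"
proof -
  have int: "integrable (measure_pmf N) G" if "\<And>x. 0 \<le> G x" "\<And>x. G x \<le> 1" for N :: "'d pmf" and G :: "'d \<Rightarrow> real"
    using that by (intro measure_pmf.integrable_const_bound[where B=1]) auto
  have E0: "0 \<le> measure_pmf.expectation (f x) F" for x
    by (intro integral_nonneg_AE) (auto simp: F)
  have E1: "measure_pmf.expectation (f x) F \<le> 1" for x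
    by (rule measure_pmf.integral_le_const) (auto intro!: int F)
  have "ennreal (measure_pmf.expectation (bind_pmf M f) F) = (\<integral>\<^sup>+x. F x \<partial>bind_pmf M f)"
    by (rule nn_integral_eq_integral[symmetric]) (auto intro!: int F)
  also have "\<dots> = (\<integral>\<^sup>+x. \<integral>\<^sup>+y. F y \<partial>f x \<partial>M)" by simp
  also have "\<dots> = (\<integral>\<^sup>+x. ennreal (measure_pmf.expectation (f x) F) \<partial>M)"
    by (intro nn_integral_cong nn_integral_eq_integral) (auto intro!: int F)
  also have "\<dots> = ennreal (measure_pmf.expectation M (\<lambda>x. measure_pmf.expectation (f x) F))"
    by (rule nn_integral_eq_integral) (auto intro!: int E0 E1)
  finally show ?thesis
    by (subst (asm) ennreal_inj) (auto intro!: integral_nonneg_AE simp: F E0)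
qed

lemma prob_bind_pmf:
  "measure_pmf.prob (bind_pmf M f) A = measure_pmf.expectation M (\<lambda>x. measure_pmf.prob (f x) A)"
  using expectation_bind_pmf[of "indicator A" M f] by simp

lemma cond_pmf_of_set:
  assumes "finite S" "S \<inter> A \<noteq> {}"
  shows "cond_pmf (pmf_of_set S) A = pmf_of_set (S \<inter> A)"
proof (rule pmf_eqI)
  fix x
  have ne: "S \<noteq> {}" "card S > 0" "card (S \<inter> A) > 0" using assms by (auto simp: card_gt_0_iff)
  then show "pmf (cond_pmf (pmf_of_set S) A) x = pmf (pmf_of_set (S \<inter> A)) x"
    using assms by (subst pmf_cond) (auto simp: measure_pmf_of_set indicator_def)
qed

section \<open>Counting assignments\<close>

locale csp_instance =
  fixes \<Phi> :: "('v, 'a, 'c) csp"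
  assumes csp: "csp_formula \<Phi>"
begin

abbreviation C where "C \<equiv> constraints \<Phi>"

text \<open>Unnormalised probabilities: for \<open>Q = all_sat C\<close> this counts the solutions
  agreeing with \<open>\<sigma>\<close>, and dropping constraints only means a smaller argument of
  \<open>all_sat\<close>.\<close>

definition cnt :: "('v \<Rightarrow> 'a pval) \<Rightarrow> (('v \<Rightarrow> 'a) \<Rightarrow> bool) \<Rightarrow> real" where
  "cnt \<sigma> Q = real (card {\<tau> \<in> assignments \<Phi>. agrees \<Phi> \<sigma> \<tau> \<and> Q \<tau>})"

definition all_sat :: "'c set \<Rightarrow> ('v \<Rightarrow> 'a) \<Rightarrow> bool" where
  "all_sat D \<tau> \<longleftrightarrow> (\<forall>c\<in>D. sat \<Phi> c \<tau>)"

lemma finite_vars [simp]: "finite (vars \<Phi>)"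
  by (simp add: vars_def)

lemma finite_Dom: "u \<in> vars \<Phi> \<Longrightarrow> finite (Dom \<Phi> u)"
  and dom_size_ge_2: "u \<in> vars \<Phi> \<Longrightarrow> dom_size \<Phi> u \<ge> 2"
  and finite_constraints [simp]: "finite C"
  and constraints_nonempty: "C \<noteq> {}"
  and vbl_subset: "c \<in> C \<Longrightarrow> vbl \<Phi> c \<subseteq> vars \<Phi>"
  and vbl_nonempty: "c \<in> C \<Longrightarrow> vbl \<Phi> c \<noteq> {}"
  using csp by (auto simp: csp_formula_def dom_size_def)

lemma finite_vbl: "c \<in> C \<Longrightarrow> finite (vbl \<Phi> c)"
  using vbl_subset finite_subset finite_vars by blast

lemma finite_assignments [simp]: "finite (assignments \<Phi>)"
  unfolding assignments_def by (intro finite_PiE) (auto intro: finite_Dom)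

lemma assignments_nonempty: "assignments \<Phi> \<noteq> {}"
  using dom_size_ge_2 by (force simp: assignments_def PiE_eq_empty_iff dom_size_def)

lemma fun_upd_assignments:
  assumes "\<tau> \<in> assignments \<Phi>" "u \<in> vars \<Phi>" "x \<in> Dom \<Phi> u"
  shows "\<tau>(u := x) \<in> assignments \<Phi>"
  using assms PiE_fun_upd[of x "Dom \<Phi>" u \<tau> "vars \<Phi>"] by (simp add: assignments_def insert_absorb)

lemma cnt_nonneg: "0 \<le> cnt \<sigma> Q"
  by (simp add: cnt_def)

lemma cnt_mono: "(\<And>\<tau>. \<tau> \<in> assignments \<Phi> \<Longrightarrow> Q \<tau> \<Longrightarrow> R \<tau>) \<Longrightarrow> cnt \<sigma> Q \<le> cnt \<sigma> R"
  unfolding cnt_def of_nat_le_iff by (intro card_mono) auto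

lemma agrees_Val:
  assumes "u \<in> vars \<Phi>" "u \<notin> assigned \<Phi> \<sigma>"
  shows "agrees \<Phi> (\<sigma>(u := Val x)) \<tau> \<longleftrightarrow> agrees \<Phi> \<sigma> \<tau> \<and> \<tau> u = x"
  using assms by (auto simp: agrees_def assigned_def)

lemma agrees_Star:
  assumes "u \<notin> assigned \<Phi> \<sigma>"
  shows "agrees \<Phi> (\<sigma>(u := Star)) \<tau> \<longleftrightarrow> agrees \<Phi> \<sigma> \<tau>"
  using assms by (auto simp: agrees_def assigned_def)

lemma cnt_Star: "u \<notin> assigned \<Phi> \<sigma> \<Longrightarrow> cnt (\<sigma>(u := Star)) Q = cnt \<sigma> Q"
  by (simp add: cnt_def agrees_Star)

lemma cnt_sum:
  assumes "u \<in> vars \<Phi>" "u \<notin> assigned \<Phi> \<sigma>"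
  shows "(\<Sum>x\<in>Dom \<Phi> u. cnt (\<sigma>(u := Val x)) Q) = cnt \<sigma> Q"
proof -
  let ?S = "\<lambda>x. {\<tau> \<in> assignments \<Phi>. agrees \<Phi> (\<sigma>(u := Val x)) \<tau> \<and> Q \<tau>}"
  have "{\<tau> \<in> assignments \<Phi>. agrees \<Phi> \<sigma> \<tau> \<and> Q \<tau>} = (\<Union>x\<in>Dom \<Phi> u. ?S x)"
    using assms by (auto simp: agrees_Val assignments_def)
  also have "card \<dots> = (\<Sum>x\<in>Dom \<Phi> u. card (?S x))"
    using assms finite_Dom by (intro card_UN_disjoint) (auto simp: agrees_Val)
  finally have "card {\<tau> \<in> assignments \<Phi>. agrees \<Phi> \<sigma> \<tau> \<and> Q \<tau>} = (\<Sum>x\<in>Dom \<Phi> u. card (?S x))" .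
  then show ?thesis unfolding cnt_def by (simp only: of_nat_sum)
qed

text \<open>Overwriting the value at \<open>u\<close> maps the assignments with one value there
  injectively to those with another and does not affect \<open>Q\<close>. So all values of
  \<open>u\<close> have equal counts, which add up to \<open>cnt \<sigma> Q\<close>.\<close>

lemma cnt_indep:
  assumes u: "u \<in> vars \<Phi>" "u \<notin> assigned \<Phi> \<sigma>" and x: "x \<in> Dom \<Phi> u"
    and Q: "\<And>\<tau> y. Q (\<tau>(u := y)) = Q \<tau>"
  shows "cnt (\<sigma>(u := Val x)) Q = cnt \<sigma> Q / real (dom_size \<Phi> u)"
proof -
  have le: "cnt (\<sigma>(u := Val y)) Q \<le> cnt (\<sigma>(u := Val z)) Q" if "z \<in> Dom \<Phi> u" for y z
    unfolding cnt_def of_nat_le_iff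
  proof (rule card_inj_on_le[where f = "\<lambda>\<tau>. \<tau>(u := z)"])
    show "inj_on (\<lambda>\<tau>. \<tau>(u := z)) {\<tau> \<in> assignments \<Phi>. agrees \<Phi> (\<sigma>(u := Val y)) \<tau> \<and> Q \<tau>}"
    proof (rule inj_onI, clarify)
      fix \<tau> \<tau>' assume *: "agrees \<Phi> (\<sigma>(u := Val y)) \<tau>" "agrees \<Phi> (\<sigma>(u := Val y)) \<tau>'"
        and eq: "\<tau>(u := z) = \<tau>'(u := z)"
      from * have "\<tau> u = \<tau>' u" using u by (simp add: agrees_Val)
      then show "\<tau> = \<tau>'" using eq by (metis fun_upd_triv fun_upd_upd)
    qed
  next
    have "agrees \<Phi> \<sigma> (\<tau>(u := z))" if "agrees \<Phi> \<sigma> \<tau>" for \<tau>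
      using that u by (auto simp: agrees_def)
    then show "(\<lambda>\<tau>. \<tau>(u := z)) ` {\<tau> \<in> assignments \<Phi>. agrees \<Phi> (\<sigma>(u := Val y)) \<tau> \<and> Q \<tau>}
        \<subseteq> {\<tau> \<in> assignments \<Phi>. agrees \<Phi> (\<sigma>(u := Val z)) \<tau> \<and> Q \<tau>}"
      using u \<open>z \<in> _\<close> by (auto simp: agrees_Val Q fun_upd_assignments)
  qed simp
  have "cnt \<sigma> Q = (\<Sum>y\<in>Dom \<Phi> u. cnt (\<sigma>(u := Val y)) Q)" using cnt_sum[OF u] by simp
  also have "\<dots> = (\<Sum>y\<in>Dom \<Phi> u. cnt (\<sigma>(u := Val x)) Q)"
    using le x by (intro sum.cong refl antisym) auto
  finally show ?thesis using dom_size_ge_2[OF u(1)] by (simp add: dom_size_def)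
qed

lemma sat_fun_upd: "u \<notin> vbl \<Phi> c \<Longrightarrow> sat \<Phi> c (\<tau>(u := y)) = sat \<Phi> c \<tau>"
proof -
  assume "u \<notin> vbl \<Phi> c"
  then have "restrict (\<tau>(u := y)) (vbl \<Phi> c) = restrict \<tau> (vbl \<Phi> c)" by (auto simp: restrict_def)
  then show ?thesis by (simp add: sat_def)
qed

lemma all_sat_fun_upd:
  "(\<And>c. c \<in> D \<Longrightarrow> u \<notin> vbl \<Phi> c) \<Longrightarrow> all_sat D (\<tau>(u := y)) = all_sat D \<tau>"
  by (simp add: all_sat_def sat_fun_upd)

lemma cnt_true_pos:
  assumes "\<sigma> \<in> partial_assignments \<Phi>"
  shows "cnt \<sigma> (\<lambda>_. True) > 0"
proof -
  obtain \<tau>\<^sub>0 where \<tau>\<^sub>0: "\<tau>\<^sub>0 \<in> assignments \<Phi>" using assignments_nonempty by blast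
  \<comment> \<open>Unassigned variables take their value from an arbitrary assignment; the test for
    \<open>vars \<Phi>\<close> keeps \<open>\<tau>\<close> undefined outside, as extensionality
    requires.\<close>
  define \<tau> where "\<tau> u = (case \<sigma> u of Val x \<Rightarrow> if u \<in> vars \<Phi> then x else \<tau>\<^sub>0 u | _ \<Rightarrow> \<tau>\<^sub>0 u)" for u
  have "\<tau> \<in> assignments \<Phi>"
    unfolding assignments_def
  proof (rule PiE_I)
    fix u assume u: "u \<in> vars \<Phi>"
    with assms have "\<sigma> u \<in> Val ` Dom \<Phi> u \<union> {Star, Unacc}" by (auto simp: partial_assignments_def)
    then show "\<tau> u \<in> Dom \<Phi> u" using u \<tau>\<^sub>0 by (auto simp: \<tau>_def assignments_def)
  next
    fix u assume "u \<notin> vars \<Phi>"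
    then show "\<tau> u = undefined" using \<tau>\<^sub>0 by (auto simp: \<tau>_def assignments_def split: pval.splits)
  qed
  moreover have "agrees \<Phi> \<sigma> \<tau>" by (auto simp: agrees_def assigned_def \<tau>_def)
  ultimately have "{\<tau> \<in> assignments \<Phi>. agrees \<Phi> \<sigma> \<tau> \<and> True} \<noteq> {}" by blast
  then show ?thesis by (simp add: cnt_def card_gt_0_iff)
qed

lemma product_pmf_eq: "product_pmf \<Phi> = pmf_of_set (assignments \<Phi>)"
proof -
  have "Dom \<Phi> u \<noteq> {}" if "u \<in> vars \<Phi>" for u
    using dom_size_ge_2[OF that] by (auto simp: dom_size_def)
  moreover have "PiE_dflt (vars \<Phi>) undefined (Dom \<Phi>) = assignments \<Phi>"
    by (auto simp: PiE_dflt_def assignments_def PiE_def Pi_def extensional_def)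
  ultimately show ?thesis
    unfolding product_pmf_def by (subst Pi_pmf_of_set) (auto intro: finite_Dom)
qed

lemma viol_prob_given_eq:
  "viol_prob_given \<Phi> c \<sigma> = cnt \<sigma> (\<lambda>\<tau>. \<not> sat \<Phi> c \<tau>) / cnt \<sigma> (\<lambda>_. True)"
proof -
  have "{\<tau> \<in> assignments \<Phi>. agrees \<Phi> \<sigma> \<tau> \<and> \<not> sat \<Phi> c \<tau>} = assignments \<Phi> \<inter> {\<tau>. \<not> sat \<Phi> c \<tau> \<and> agrees \<Phi> \<sigma> \<tau>}"
    "{\<tau> \<in> assignments \<Phi>. agrees \<Phi> \<sigma> \<tau> \<and> True} = assignments \<Phi> \<inter> {\<tau>. agrees \<Phi> \<sigma> \<tau>}"
    by auto
  moreover have "card (assignments \<Phi>) > 0" by (simp add: card_gt_0_iff assignments_nonempty)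
  ultimately show ?thesis
    by (simp add: viol_prob_given_def cond_prob_def product_pmf_eq measure_pmf_of_set
        assignments_nonempty cnt_def)
qed

lemma solutions_eq: "solutions \<Phi> = {\<tau> \<in> assignments \<Phi>. all_sat C \<tau>}"
  by (auto simp: solutions_def all_sat_def)

text \<open>Conditioning the uniform distribution on solutions restricts it to the agreeing ones.
  After multiplication by the count at \<open>\<sigma>\<close> only the count after the step
  remains, which is why the later inductions carry the factor
  \<open>cnt \<sigma> (all_sat C)\<close>.\<close>

lemma pmf_marginal:
  assumes u: "u \<in> vars \<Phi>" "u \<notin> assigned \<Phi> \<sigma>" and pos: "cnt \<sigma> (all_sat C) > 0"
  shows "pmf (marginal \<Phi> \<sigma> u) x = cnt (\<sigma>(u := Val x)) (all_sat C) / cnt \<sigma> (all_sat C)"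
proof -
  have eq: "{\<tau> \<in> assignments \<Phi>. agrees \<Phi> \<sigma> \<tau> \<and> all_sat C \<tau>} = solutions \<Phi> \<inter> {\<tau>. agrees \<Phi> \<sigma> \<tau>}"
    by (auto simp: solutions_eq)
  have ne: "solutions \<Phi> \<inter> {\<tau>. agrees \<Phi> \<sigma> \<tau>} \<noteq> {}" and fin: "finite (solutions \<Phi>)"
    using pos by (auto simp: cnt_def card_gt_0_iff eq solutions_eq)
  have "marginal \<Phi> \<sigma> u = map_pmf (\<lambda>\<tau>. \<tau> u) (pmf_of_set (solutions \<Phi> \<inter> {\<tau>. agrees \<Phi> \<sigma> \<tau>}))"
    unfolding marginal_def using cond_pmf_of_set[OF fin ne] by simp
  then have "pmf (marginal \<Phi> \<sigma> u) x =
      real (card (solutions \<Phi> \<inter> {\<tau>. agrees \<Phi> \<sigma> \<tau>} \<inter> ((\<lambda>\<tau>. \<tau> u) -` {x}))) / cnt \<sigma> (all_sat C)"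
    using ne fin by (simp add: pmf_map measure_pmf_of_set cnt_def eq)
  also have "solutions \<Phi> \<inter> {\<tau>. agrees \<Phi> \<sigma> \<tau>} \<inter> ((\<lambda>\<tau>. \<tau> u) -` {x}) =
      {\<tau> \<in> assignments \<Phi>. agrees \<Phi> (\<sigma>(u := Val x)) \<tau> \<and> all_sat C \<tau>}"
    using u by (auto simp: solutions_eq agrees_Val)
  finally show ?thesis by (simp add: cnt_def)
qed

lemma set_pmf_marginal:
  assumes u: "u \<in> vars \<Phi>" "u \<notin> assigned \<Phi> \<sigma>" and pos: "cnt \<sigma> (all_sat C) > 0"
  shows "set_pmf (marginal \<Phi> \<sigma> u) \<subseteq> Dom \<Phi> u"
proof
  fix x assume "x \<in> set_pmf (marginal \<Phi> \<sigma> u)"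
  then have "cnt (\<sigma>(u := Val x)) (all_sat C) \<noteq> 0"
    using pmf_marginal[OF assms, of x] by (auto simp: set_pmf_iff)
  then obtain \<tau> where "\<tau> \<in> assignments \<Phi>" "agrees \<Phi> (\<sigma>(u := Val x)) \<tau>"
    by (force simp: cnt_def)
  then show "x \<in> Dom \<Phi> u" using u by (auto simp: agrees_Val assignments_def)
qed

section \<open>The local lemma\<close>

abbreviation blank :: "'v \<Rightarrow> 'a pval" where "blank \<equiv> (\<lambda>_. Unacc)"

abbreviation \<Delta> where "\<Delta> \<equiv> csp_degree \<Phi>"

text \<open>Closed neighbourhoods in the dependency graph: a constraint is its own neighbour, as in
  \<open>csp_degree\<close>.\<close>

definition nbrs :: "'c \<Rightarrow> 'c set" where
  "nbrs c = {c' \<in> C. vbl \<Phi> c \<inter> vbl \<Phi> c' \<noteq> {}}"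

lemma finite_nbrs [simp]: "finite (nbrs c)"
  by (simp add: nbrs_def)

lemma card_nbrs_le: "c \<in> C \<Longrightarrow> card (nbrs c) \<le> \<Delta>"
  unfolding nbrs_def csp_degree_def by (intro Max_ge) auto

lemma nbrs_refl: "c \<in> C \<Longrightarrow> c \<in> nbrs c"
  using vbl_nonempty by (auto simp: nbrs_def)

lemma degree_pos: "\<Delta> \<ge> 1"
proof -
  obtain c where c: "c \<in> C" using constraints_nonempty by blast
  then have "card (nbrs c) \<ge> 1" using nbrs_refl by (auto simp: Suc_le_eq card_gt_0_iff)
  then show ?thesis using card_nbrs_le[OF c] by linarith
qed

lemma agrees_blank [simp]: "agrees \<Phi> blank \<tau>"
  by (auto simp: agrees_def assigned_def)

text \<open>Swapping the coordinates in \<open>S\<close> is an involution on pairs of assignments.\<close>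

lemma cnt_mult:
  assumes Q: "\<And>\<tau> \<tau>'. (\<And>u. u \<in> S \<Longrightarrow> \<tau> u = \<tau>' u) \<Longrightarrow> Q \<tau> = Q \<tau>'"
    and R: "\<And>\<tau> \<tau>'. (\<And>u. u \<notin> S \<Longrightarrow> \<tau> u = \<tau>' u) \<Longrightarrow> R \<tau> = R \<tau>'"
  shows "cnt blank (\<lambda>\<tau>. R \<tau> \<and> Q \<tau>) * cnt blank (\<lambda>_. True) = cnt blank R * cnt blank Q"
proof -
  define mix where "mix = (\<lambda>(a :: 'v \<Rightarrow> 'a) b u. if u \<in> S then b u else a u)"
  let ?A = "assignments \<Phi>"
  have mix: "mix a b \<in> ?A" if "a \<in> ?A" "b \<in> ?A" for a b
    using that by (auto simp: assignments_def mix_def PiE_def Pi_def extensional_def)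
  have Qm: "Q (mix a b) = Q b" and Rm: "R (mix a b) = R a" for a b
    using Q[of "mix a b" b] R[of "mix a b" a] by (simp_all add: mix_def)
  have mm: "mix (mix a b) (mix b a) = a" for a b
    by (auto simp: mix_def)
  have "bij_betw (\<lambda>(a, b). (mix a b, mix b a))
      ({\<tau> \<in> ?A. R \<tau> \<and> Q \<tau>} \<times> ?A) ({\<tau> \<in> ?A. R \<tau>} \<times> {\<tau> \<in> ?A. Q \<tau>})"
    by (rule bij_betw_byWitness[where f' = "\<lambda>(a, b). (mix a b, mix b a)"])
      (auto simp: mm mix Qm Rm)
  from bij_betw_same_card[OF this] show ?thesis
    by (simp add: cnt_def card_cartesian_product flip: of_nat_mult)
qed

lemma sat_cong: "(\<And>u. u \<in> vbl \<Phi> c \<Longrightarrow> \<tau> u = \<tau>' u) \<Longrightarrow> sat \<Phi> c \<tau> = sat \<Phi> c \<tau>'"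
  by (auto simp: sat_def intro!: arg_cong[where f = "holds \<Phi> c"] restrict_ext)

lemma cnt_not_sat_le:
  assumes "c \<in> C"
  shows "cnt blank (\<lambda>\<tau>. \<not> sat \<Phi> c \<tau>) \<le> viol_prob \<Phi> * cnt blank (\<lambda>_. True)"
proof -
  have "measure_pmf.prob (product_pmf \<Phi>) {\<tau>. \<not> sat \<Phi> c \<tau>} \<le> viol_prob \<Phi>"
    unfolding viol_prob_def using assms by (intro Max_ge) auto
  moreover have "assignments \<Phi> \<inter> {\<tau>. \<not> sat \<Phi> c \<tau>} = {\<tau> \<in> assignments \<Phi>. \<not> sat \<Phi> c \<tau>}"
    by auto
  moreover have "card (assignments \<Phi>) > 0" by (simp add: card_gt_0_iff assignments_nonempty)
  ultimately show ?thesis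
    by (simp add: product_pmf_eq measure_pmf_of_set assignments_nonempty cnt_def field_simps)
qed

lemma viol_prob_nonneg: "viol_prob \<Phi> \<ge> 0"
proof -
  obtain c where c: "c \<in> C" using constraints_nonempty by blast
  have "0 \<le> measure_pmf.prob (product_pmf \<Phi>) {\<tau>. \<not> sat \<Phi> c \<tau>}" by simp
  also have "\<dots> \<le> viol_prob \<Phi>"
    unfolding viol_prob_def using c by (intro Max_ge) auto
  finally show ?thesis .
qed

text \<open>The constraints of \<open>F\<close> are added one at a time, each keeping at least the
  fraction \<open>a\<close>. The hypothesis concerns only \<open>f\<close> outside
  \<open>F'\<close>, so an induction on the number of constraints can supply it.\<close>

lemma cnt_chain:
  assumes "finite F" and a: "(a :: real) \<ge> 0"
    and step: "\<And>F' f. F' \<subseteq> F \<Longrightarrow> f \<in> F - F' \<Longrightarrow>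
      cnt blank (all_sat (insert f (E \<union> F'))) \<ge> a * cnt blank (all_sat (E \<union> F'))"
  shows "cnt blank (all_sat (E \<union> F)) \<ge> a ^ card F * cnt blank (all_sat E)"
  using \<open>finite F\<close> subset_refl[of F]
proof (induction rule: finite_subset_induct')
  case (insert f F')
  have "a ^ card (insert f F') * cnt blank (all_sat E) = a * (a ^ card F' * cnt blank (all_sat E))"
    using insert by simp
  also have "\<dots> \<le> a * cnt blank (all_sat (E \<union> F'))"
    using insert a by (intro mult_left_mono) auto
  also have "\<dots> \<le> cnt blank (all_sat (insert f (E \<union> F')))"
    using insert by (intro step) auto
  finally show ?case by simp
qed simp

text \<open>The weights of the local lemma are all taken to be \<open>2p\<close>.\<close>

lemma local_lemma:
  assumes small: "4 * viol_prob \<Phi> * real \<Delta> \<le> 1" and "D \<subseteq> C" "c \<in> C"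
  shows "cnt blank (all_sat D) > 0 \<and>
    cnt blank (all_sat (insert c D)) \<ge> (1 - 2 * viol_prob \<Phi>) * cnt blank (all_sat D)"
  using assms(2,3)
proof (induction "card D" arbitrary: D c rule: less_induct)
  case less
  let ?p = "viol_prob \<Phi>" and ?N = "\<lambda>D. cnt blank (all_sat D)"
  have finD: "finite D" using less.prems(1) finite_constraints by (rule finite_subset)
  have "?p * 1 \<le> ?p * real \<Delta>" using degree_pos viol_prob_nonneg by (intro mult_left_mono) auto
  then have p: "0 \<le> ?p" "?p \<le> 1/4" using small viol_prob_nonneg by auto
  have pos: "?N D > 0"
  proof (cases "D = {}")
    case True
    then have "all_sat D = (\<lambda>_. True)" by (auto simp: all_sat_def)
    then show ?thesis using cnt_true_pos[of blank] by (simp add: partial_assignments_def)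
  next
    case False
    then obtain d where d: "d \<in> D" by blast
    have "?N (D - {d}) > 0 \<and> ?N (insert d (D - {d})) \<ge> (1 - 2 * ?p) * ?N (D - {d})"
      using less.prems d finD by (intro less.hyps psubset_card_mono) auto
    moreover have "(1 - 2 * ?p) * ?N (D - {d}) > 0" if "?N (D - {d}) > 0"
      using that p by simp
    ultimately have "?N (insert d (D - {d})) > 0" by linarith
    then show ?thesis using d by (simp add: insert_absorb)
  qed
  moreover have "?N (insert c D) \<ge> (1 - 2 * ?p) * ?N D"
  proof (cases "c \<in> D")
    case True
    then show ?thesis using p pos by (simp add: insert_absorb mult_le_cancel_right1)
  next
    case False
    \<comment> \<open>\<open>D\<close> is split into the constraints disjoint from \<open>c\<close>,
      which are independent of \<open>c\<close>, and the at most \<open>\<Delta>\<close> neighbours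
      of \<open>c\<close>, which together keep at least half of the assignments.\<close>
    define E where "E = D - nbrs c"
    define F where "F = D \<inter> nbrs c"
    have EF: "D = E \<union> F" "E \<inter> F = {}" "finite F" using finD by (auto simp: E_def F_def)
    have "?N (E \<union> F) \<ge> (1 - 2 * ?p) ^ card F * ?N E"
    proof (rule cnt_chain)
      \<comment> \<open>\<open>E \<union> F'\<close> misses \<open>f\<close>, hence is a proper
        subset of \<open>D\<close>, and the induction hypothesis applies.\<close>
      fix F' f assume "F' \<subseteq> F" "f \<in> F - F'"
      then show "?N (insert f (E \<union> F')) \<ge> (1 - 2 * ?p) * ?N (E \<union> F')"
        using less.prems finD EF by (intro conjunct2[OF less.hyps] psubset_card_mono) auto
    qed (use EF p in auto)
    moreover have "1/2 \<le> (1 - 2 * ?p) ^ card F"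
    proof -
      have "card F \<le> \<Delta>"
        using card_mono[of "nbrs c" F] card_nbrs_le[of c] less.prems by (simp add: F_def)
      then have "?p * real (card F) \<le> ?p * real \<Delta>" using p by (intro mult_left_mono) auto
      then have "1/2 \<le> 1 + real (card F) * (- (2 * ?p))" using small by (simp add: algebra_simps)
      also have "\<dots> \<le> (1 + - (2 * ?p)) ^ card F" using p by (intro Bernoulli_inequality) auto
      finally show ?thesis by simp
    qed
    ultimately have half: "1/2 * ?N E \<le> ?N D"
      using EF mult_right_mono[of "1/2" "(1 - 2 * ?p) ^ card F" "?N E"] cnt_nonneg[of blank] by (smt (verit))
    let ?T = "cnt blank (\<lambda>_. True)"
    have T: "?T > 0" by (rule cnt_true_pos) (simp add: partial_assignments_def)
    have "cnt blank (\<lambda>\<tau>. all_sat E \<tau> \<and> \<not> sat \<Phi> c \<tau>) * ?T = ?N E * cnt blank (\<lambda>\<tau>. \<not> sat \<Phi> c \<tau>)"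
    proof (rule cnt_mult[where S = "vbl \<Phi> c"])
      fix \<tau> \<tau>' :: "'v \<Rightarrow> 'a" assume *: "\<And>u. u \<notin> vbl \<Phi> c \<Longrightarrow> \<tau> u = \<tau>' u"
      have "sat \<Phi> d \<tau> = sat \<Phi> d \<tau>'" if "d \<in> E" for d
        using that less.prems by (intro sat_cong *) (auto simp: E_def nbrs_def)
      then show "all_sat E \<tau> = all_sat E \<tau>'" by (simp add: all_sat_def)
    next
      fix \<tau> \<tau>' :: "'v \<Rightarrow> 'a" assume "\<And>u. u \<in> vbl \<Phi> c \<Longrightarrow> \<tau> u = \<tau>' u"
      then show "(\<not> sat \<Phi> c \<tau>) = (\<not> sat \<Phi> c \<tau>')" using sat_cong by metis
    qed
    also have "\<dots> \<le> ?N E * (?p * ?T)"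
      using cnt_not_sat_le less.prems by (intro mult_left_mono cnt_nonneg) auto
    finally have "cnt blank (\<lambda>\<tau>. all_sat E \<tau> \<and> \<not> sat \<Phi> c \<tau>) \<le> ?p * ?N E"
      using T by (simp add: mult.left_commute)
    moreover have "cnt blank (\<lambda>\<tau>. all_sat D \<tau> \<and> \<not> sat \<Phi> c \<tau>) \<le> cnt blank (\<lambda>\<tau>. all_sat E \<tau> \<and> \<not> sat \<Phi> c \<tau>)"
      by (intro cnt_mono) (auto simp: all_sat_def E_def)
    \<comment> \<open>The factor 2 lost in passing from \<open>E\<close> to \<open>D\<close> is what
      makes the weight \<open>2p\<close> reproduce itself.\<close>
    moreover have "?p * ?N E \<le> ?p * (2 * ?N D)" using half p by (intro mult_left_mono) auto
    ultimately have viol: "cnt blank (\<lambda>\<tau>. all_sat D \<tau> \<and> \<not> sat \<Phi> c \<tau>) \<le> 2 * ?p * ?N D" by simp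
    have "{\<tau> \<in> assignments \<Phi>. agrees \<Phi> blank \<tau> \<and> all_sat D \<tau>} =
        {\<tau> \<in> assignments \<Phi>. agrees \<Phi> blank \<tau> \<and> all_sat (insert c D) \<tau>} \<union>
        {\<tau> \<in> assignments \<Phi>. agrees \<Phi> blank \<tau> \<and> all_sat D \<tau> \<and> \<not> sat \<Phi> c \<tau>}"
      by (auto simp: all_sat_def)
    then have "?N D \<le> ?N (insert c D) + cnt blank (\<lambda>\<tau>. all_sat D \<tau> \<and> \<not> sat \<Phi> c \<tau>)"
      unfolding cnt_def of_nat_add[symmetric] of_nat_le_iff by (simp only: card_Un_le)
    then show ?thesis using viol by (simp add: algebra_simps)
  qed
  ultimately show ?case by blast
qed

text \<open>At most \<open>\<Delta>\<close> constraints meet a given member of \<open>T\<close>.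
  Restoring them one by one costs a factor \<open>(1 - 2p) ^ \<Delta>\<close> per member, which is
  at least \<open>1 - 2p\<Delta>\<close> by Bernoulli's inequality.\<close>

lemma local_lemma_ratio:
  assumes small: "4 * viol_prob \<Phi> * real \<Delta> \<le> 1" and T: "T \<subseteq> C"
  shows "cnt blank (all_sat C) > 0"
    and "cnt blank (all_sat {c \<in> C. vbl \<Phi> c \<inter> (\<Union>d\<in>T. vbl \<Phi> d) = {}}) *
      (1 - 2 * viol_prob \<Phi> * real \<Delta>) ^ card T \<le> cnt blank (all_sat C)"
proof -
  let ?p = "viol_prob \<Phi>" and ?N = "\<lambda>D. cnt blank (all_sat D)"
  obtain c0 where "c0 \<in> C" using constraints_nonempty by blast
  then show "?N C > 0" using local_lemma[OF small] by blast
  have "?p * 1 \<le> ?p * real \<Delta>" using degree_pos viol_prob_nonneg by (intro mult_left_mono) auto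
  then have p: "0 \<le> ?p" "?p \<le> 1/4" "2 * ?p * real \<Delta> \<le> 1/2" using small viol_prob_nonneg by auto
  define E where "E = {c \<in> C. vbl \<Phi> c \<inter> (\<Union>d\<in>T. vbl \<Phi> d) = {}}"
  define F where "F = (\<Union>d\<in>T. nbrs d)"
  have fin: "finite T" using T finite_constraints by (rule finite_subset)
  have EF: "C = E \<union> F" using T by (auto simp: E_def F_def nbrs_def)
  have "card F \<le> (\<Sum>d\<in>T. card (nbrs d))" unfolding F_def by (rule card_UN_le[OF fin])
  also have "\<dots> \<le> (\<Sum>d\<in>T. \<Delta>)" using T card_nbrs_le by (intro sum_mono) auto
  finally have cF: "card F \<le> \<Delta> * card T" by (simp add: mult.commute)
  have "1 - 2 * ?p * real \<Delta> = 1 + real \<Delta> * (- (2 * ?p))" by simp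
  also have "\<dots> \<le> (1 + - (2 * ?p)) ^ \<Delta>" using p by (intro Bernoulli_inequality) auto
  finally have "(1 - 2 * ?p * real \<Delta>) ^ card T \<le> ((1 - 2 * ?p) ^ \<Delta>) ^ card T"
    using p by (intro power_mono) auto
  also have "\<dots> = (1 - 2 * ?p) ^ (\<Delta> * card T)" by (simp add: power_mult)
  also have "\<dots> \<le> (1 - 2 * ?p) ^ card F" using cF p by (intro power_decreasing) auto
  finally have "?N E * (1 - 2 * ?p * real \<Delta>) ^ card T \<le> ?N E * (1 - 2 * ?p) ^ card F"
    by (intro mult_left_mono cnt_nonneg)
  also have "\<dots> = (1 - 2 * ?p) ^ card F * ?N E" by simp
  also have "\<dots> \<le> ?N (E \<union> F)"
  proof (rule cnt_chain)
    fix F' f assume "F' \<subseteq> F" "f \<in> F - F'"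
    then show "?N (insert f (E \<union> F')) \<ge> (1 - 2 * ?p) * ?N (E \<union> F')"
      using EF by (intro conjunct2[OF local_lemma[OF small]]) auto
  qed (use p fin in \<open>auto simp: F_def\<close>)
  finally show "?N E * (1 - 2 * ?p * real \<Delta>) ^ card T \<le> ?N C" using EF by simp
qed

section \<open>The supermartingale\<close>

lemma max_dom_ge: "u \<in> vars \<Phi> \<Longrightarrow> dom_size \<Phi> u \<le> max_dom \<Phi>"
  unfolding max_dom_def by (intro Max_ge) auto

lemma max_dom_ge_2: "max_dom \<Phi> \<ge> 2"
proof -
  obtain c where c: "c \<in> C" using constraints_nonempty by blast
  then obtain u where "u \<in> vars \<Phi>" using vbl_nonempty vbl_subset by blast
  then show ?thesis using dom_size_ge_2 max_dom_ge order_trans by blast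
qed

lemma width_ge: "c \<in> C \<Longrightarrow> card (vbl \<Phi> c) \<le> csp_width \<Phi>"
  unfolding csp_width_def by (intro Max_ge) auto

lemma width_pos: "csp_width \<Phi> \<ge> 1"
proof -
  obtain c where c: "c \<in> C" using constraints_nonempty by blast
  then have "card (vbl \<Phi> c) \<ge> 1"
    using finite_vbl vbl_nonempty by (simp add: Suc_le_eq card_gt_0_iff)
  then show ?thesis using width_ge[OF c] by linarith
qed

lemma p_thr_pos: "p_thr \<Phi> > 0"
  using max_dom_ge_2 width_pos degree_pos by (simp add: p_thr_def)

text \<open>An upper bound, uniform over the variables, for the probability that a step of the path
  writes \<open>Star\<close>.\<close>

definition star_bound :: real where
  "star_bound = real (max_dom \<Phi>) * (eta \<Phi> + zeta \<Phi>)"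

lemma exp_1_ge: "exp 1 \<ge> (5/2 :: real)"
  using exp_lower_Taylor_quadratic[of 1] by (simp add: power2_eq_square)

text \<open>With \<open>x = e p' q\<close>, Bernoulli's inequality gives
  \<open>eta \<le> \<Delta>x / (1 - \<Delta>x)\<close>. Since \<open>e \<ge> 5/2\<close> and
  \<open>q \<ge> 2\<close>, one has \<open>\<Delta>x \<le> 1/90\<close>, so the denominator costs a
  factor of at most \<open>90/89\<close>.\<close>

lemma eta_bounds:
  shows "0 \<le> eta \<Phi>"
    and "eta \<Phi> \<le> 90/89 / (18 * exp 1 * real (max_dom \<Phi>) * real (csp_width \<Phi>) * real \<Delta> ^ 3)"
proof -
  let ?q = "real (max_dom \<Phi>)" and ?k = "real (csp_width \<Phi>)" and ?D = "real \<Delta>"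
  have pos: "?q \<ge> 2" "?k \<ge> 1" "?D \<ge> 1" using max_dom_ge_2 width_pos degree_pos by simp_all
  define x where "x = exp 1 * p_thr \<Phi> * ?q"
  have x: "x = 1 / (18 * exp 1 * ?q * ?k * ?D ^ 4)"
    using pos by (simp add: x_def p_thr_def power2_eq_square)
  then have Dx: "?D * x = 1 / (18 * exp 1 * ?q * ?k * ?D ^ 3)"
    using pos by (simp add: power_numeral_reduce)
  have "(5/2) * 2 * 1 * 1 \<le> exp 1 * ?q * ?k * ?D ^ 3"
    using pos exp_1_ge by (intro mult_mono) (auto simp: one_le_power)
  then have Dx90: "?D * x \<le> 1/90" unfolding Dx by (simp add: field_simps)
  have x0: "0 \<le> x" using pos by (simp add: x)
  have "1 * x \<le> ?D * x" using pos x0 by (intro mult_right_mono) auto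
  then have x1: "x \<le> 1/90" using Dx90 by simp
  have eta: "eta \<Phi> = inverse ((1 - x) ^ \<Delta>) - 1"
    by (simp add: eta_def x_def power_int_minus)
  show "0 \<le> eta \<Phi>" using x0 x1 by (simp add: eta one_le_inverse_iff power_le_one)
  have "1 - ?D * x = 1 + ?D * (- x)" by simp
  also have "\<dots> \<le> (1 + - x) ^ \<Delta>" using x1 by (intro Bernoulli_inequality) auto
  finally have "inverse ((1 - x) ^ \<Delta>) \<le> inverse (1 - ?D * x)"
    using Dx90 by (intro le_imp_inverse_le) auto
  then have "eta \<Phi> \<le> inverse (1 - ?D * x) - 1" by (simp add: eta)
  also have "\<dots> = ?D * x * inverse (1 - ?D * x)" using Dx90 by (simp add: field_simps)
  also have "\<dots> \<le> ?D * x * inverse (89/90)"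
    using Dx90 x0 by (intro mult_left_mono le_imp_inverse_le) auto
  finally show "eta \<Phi> \<le> 90/89 / (18 * exp 1 * ?q * ?k * ?D ^ 3)" by (simp add: Dx)
qed

lemma zeta_nonneg: "0 \<le> zeta \<Phi>"
  by (simp add: zeta_def)

lemma star_bound_nonneg: "0 \<le> star_bound"
  using eta_bounds zeta_nonneg by (simp add: star_bound_def)

text \<open>For \<open>r \<le> 1\<close> the denominator is at least 1, and \<open>1 - r\<close>
  equals the domain size times \<open>eta + zeta\<close>.\<close>

lemma star_prob_le:
  assumes "u \<in> vars \<Phi>"
  defines "r \<equiv> real (dom_size \<Phi> u) * theta \<Phi> u"
  shows "(1 - r) / (2 - r) \<le> star_bound"
proof -
  have r: "r \<le> 1" unfolding r_def by (rule dom_size_theta_le_1[OF csp assms(1)])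
  have "(1 - r) / (2 - r) \<le> (1 - r) / 1" using r by (intro divide_left_mono) auto
  also have "\<dots> = real (dom_size \<Phi> u) * (eta \<Phi> + zeta \<Phi>)"
    using dom_size_ge_2[OF assms(1)] by (simp add: r_def theta_def algebra_simps)
  also have "\<dots> \<le> star_bound"
    unfolding star_bound_def using max_dom_ge[OF assms(1)] eta_bounds zeta_nonneg
    by (intro mult_right_mono) auto
  finally show ?thesis .
qed

text \<open>\<open>Unacc\<close> weighs as much as a revealed variable can weigh on average:
  \<open>Star\<close>, of weight 1, appears with probability at most
  \<open>star_bound\<close>.\<close>

fun access_weight :: "'a pval \<Rightarrow> real" where
  "access_weight (Val x) = 0"
| "access_weight Star = 1"
| "access_weight Unacc = star_bound"

text \<open>
  At least \<open>1\<close> when \<open>c\<close> is frozen or contains a \<open>Star\<close>; a supermartingale if the variables are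
  revealed one at a time, with values from the uniform distribution.
\<close>

definition pot :: "'c \<Rightarrow> ('v \<Rightarrow> 'a pval) \<Rightarrow> real" where
  "pot c \<sigma> = viol_prob_given \<Phi> c \<sigma> / (0.99 * p_thr \<Phi>) + (\<Sum>u\<in>vbl \<Phi> c. access_weight (\<sigma> u))"

lemma access_weight_nonneg: "0 \<le> access_weight y"
  by (cases y) (auto simp: star_bound_nonneg)

lemma viol_prob_given_nonneg: "0 \<le> viol_prob_given \<Phi> c \<sigma>"
  by (simp add: viol_prob_given_eq cnt_nonneg)

lemma pot_nonneg: "0 \<le> pot c \<sigma>"
  using p_thr_pos
  by (auto simp: pot_def viol_prob_given_nonneg access_weight_nonneg intro!: add_nonneg_nonneg sum_nonneg)

lemma viol_prob_given_Star: "u \<notin> assigned \<Phi> \<sigma> \<Longrightarrow> viol_prob_given \<Phi> c (\<sigma>(u := Star)) = viol_prob_given \<Phi> c \<sigma>"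
  by (simp add: viol_prob_given_eq cnt_Star)

lemma pot_Star_outside:
  "u \<notin> assigned \<Phi> \<sigma> \<Longrightarrow> u \<notin> vbl \<Phi> c \<Longrightarrow> pot c (\<sigma>(u := Star)) = pot c \<sigma>"
  by (auto simp: pot_def viol_prob_given_Star intro!: sum.cong)

text \<open>Fixing a variable outside the scope divides both counts in the violation probability by
  the domain size.\<close>

lemma pot_Val_outside:
  assumes u: "u \<in> vars \<Phi>" "u \<notin> assigned \<Phi> \<sigma>" and x: "x \<in> Dom \<Phi> u" and "u \<notin> vbl \<Phi> c"
  shows "pot c (\<sigma>(u := Val x)) = pot c \<sigma>"
proof -
  have "cnt (\<sigma>(u := Val x)) (\<lambda>\<tau>. \<not> sat \<Phi> c \<tau>) = cnt \<sigma> (\<lambda>\<tau>. \<not> sat \<Phi> c \<tau>) / dom_size \<Phi> u"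
    using assms by (intro cnt_indep) (simp_all add: sat_fun_upd)
  moreover have "cnt (\<sigma>(u := Val x)) (\<lambda>_. True) = cnt \<sigma> (\<lambda>_. True) / dom_size \<Phi> u"
    using assms by (intro cnt_indep) simp_all
  ultimately have "viol_prob_given \<Phi> c (\<sigma>(u := Val x)) = viol_prob_given \<Phi> c \<sigma>"
    using dom_size_ge_2[OF u(1)] by (simp add: viol_prob_given_eq)
  then show ?thesis using assms by (auto simp: pot_def intro!: sum.cong)
qed

lemma sum_access_weight_upd:
  assumes "c \<in> C" "u \<in> vbl \<Phi> c" "\<sigma> u = Unacc"
  shows "(\<Sum>v\<in>vbl \<Phi> c. access_weight ((\<sigma>(u := y)) v)) =
    (\<Sum>v\<in>vbl \<Phi> c. access_weight (\<sigma> v)) - star_bound + access_weight y"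
proof -
  note fin = finite_vbl[OF assms(1)]
  have "(\<Sum>v\<in>vbl \<Phi> c. access_weight ((\<sigma>(u := y)) v)) =
      access_weight y + (\<Sum>v\<in>vbl \<Phi> c - {u}. access_weight (\<sigma> v))"
    using assms fin by (subst sum.remove[of _ u]) auto
  also have "(\<Sum>v\<in>vbl \<Phi> c - {u}. access_weight (\<sigma> v)) = (\<Sum>v\<in>vbl \<Phi> c. access_weight (\<sigma> v)) - star_bound"
    using assms fin by (subst (2) sum.remove[of _ u]) auto
  finally show ?thesis by simp
qed

lemma pot_Star_inside:
  assumes "c \<in> C" "u \<in> vbl \<Phi> c" "\<sigma> u = Unacc"
  shows "pot c (\<sigma>(u := Star)) = pot c \<sigma> - star_bound + 1"
proof -
  have "u \<notin> assigned \<Phi> \<sigma>" using assms by (auto simp: assigned_def)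
  then show ?thesis
    unfolding pot_def sum_access_weight_upd[where \<sigma> = \<sigma>, OF assms] by (simp add: viol_prob_given_Star)
qed

text \<open>By total probability the violation probability keeps its average over the values of
  \<open>u\<close>, while the weight \<open>star_bound\<close> of the unaccessed \<open>u\<close>
  disappears.\<close>

lemma pot_Val_inside:
  assumes c: "c \<in> C" "u \<in> vbl \<Phi> c" "\<sigma> u = Unacc" and \<sigma>: "\<sigma> \<in> partial_assignments \<Phi>"
  shows "(\<Sum>x\<in>Dom \<Phi> u. pot c (\<sigma>(u := Val x))) = real (dom_size \<Phi> u) * (pot c \<sigma> - star_bound)"
proof -
  have u: "u \<in> vars \<Phi>" "u \<notin> assigned \<Phi> \<sigma>" using c vbl_subset by (auto simp: assigned_def)
  let ?q = "real (dom_size \<Phi> u)" and ?a = "\<Sum>v\<in>vbl \<Phi> c. access_weight (\<sigma> v)"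
  let ?d = "0.99 * p_thr \<Phi>"
  have v: "viol_prob_given \<Phi> c (\<sigma>(u := Val x)) =
      ?q * cnt (\<sigma>(u := Val x)) (\<lambda>\<tau>. \<not> sat \<Phi> c \<tau>) / cnt \<sigma> (\<lambda>_. True)" if "x \<in> Dom \<Phi> u" for x
    using that u dom_size_ge_2[OF u(1)] by (simp add: viol_prob_given_eq cnt_indep[where Q = "\<lambda>_. True"])
  have "(\<Sum>x\<in>Dom \<Phi> u. viol_prob_given \<Phi> c (\<sigma>(u := Val x))) =
      (\<Sum>x\<in>Dom \<Phi> u. ?q * cnt (\<sigma>(u := Val x)) (\<lambda>\<tau>. \<not> sat \<Phi> c \<tau>) / cnt \<sigma> (\<lambda>_. True))"
    by (intro sum.cong refl v)
  also have "\<dots> = ?q * (\<Sum>x\<in>Dom \<Phi> u. cnt (\<sigma>(u := Val x)) (\<lambda>\<tau>. \<not> sat \<Phi> c \<tau>)) / cnt \<sigma> (\<lambda>_. True)"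
    by (simp add: sum_distrib_left sum_divide_distrib)
  also have "\<dots> = ?q * viol_prob_given \<Phi> c \<sigma>"
    using u by (simp add: cnt_sum viol_prob_given_eq)
  finally have "(\<Sum>x\<in>Dom \<Phi> u. viol_prob_given \<Phi> c (\<sigma>(u := Val x))) = ?q * viol_prob_given \<Phi> c \<sigma>" .
  moreover have "(\<Sum>x\<in>Dom \<Phi> u. pot c (\<sigma>(u := Val x))) =
      (\<Sum>x\<in>Dom \<Phi> u. viol_prob_given \<Phi> c (\<sigma>(u := Val x))) / ?d + ?q * (?a - star_bound)"
    unfolding pot_def sum_access_weight_upd[where \<sigma> = \<sigma>, OF c]
    by (simp only: sum.distrib sum_divide_distrib) (simp add: dom_size_def algebra_simps)
  ultimately show ?thesis by (simp add: pot_def algebra_simps)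
qed

text \<open>\<open>T\<close> holds the constraints still expected to become bad, \<open>D\<close>
  those kept in the solution count.\<close>

definition weight :: "'c set \<Rightarrow> 'c set \<Rightarrow> ('v \<Rightarrow> 'a pval) \<Rightarrow> real" where
  "weight D T \<sigma> = cnt \<sigma> (all_sat D) * (\<Prod>c\<in>T. pot c \<sigma>)"

lemma weight_nonneg: "0 \<le> weight D T \<sigma>"
  by (simp add: weight_def cnt_nonneg prod_nonneg pot_nonneg)

text \<open>Disjoint scopes in \<open>T\<close> let a variable affect at most one factor of the
  product; disjointness from \<open>D\<close> makes the variables of \<open>T\<close> uniform under
  the count for \<open>D\<close>.\<close>

definition separated :: "'c set \<Rightarrow> 'c set \<Rightarrow> bool" where
  "separated D T \<longleftrightarrow> T \<subseteq> C \<and> D \<subseteq> C \<and> pairwise (\<lambda>c d. vbl \<Phi> c \<inter> vbl \<Phi> d = {}) T \<and>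
     (\<forall>c\<in>T. \<forall>d\<in>D. vbl \<Phi> c \<inter> vbl \<Phi> d = {})"

lemma separated_subset: "separated D T \<Longrightarrow> T' \<subseteq> T \<Longrightarrow> separated D T'"
  unfolding separated_def by (blast intro: pairwise_subset)

text \<open>A variable outside the scopes of \<open>T\<close> changes no potential, and the counts
  add up. A variable of some \<open>c \<in> T\<close> changes only the potential of
  \<open>c\<close>, whose access weight loses \<open>star_bound\<close> and gains
  \<open>\<beta>\<close> on average. The case \<open>\<beta> = 0\<close> covers plain draws from the
  marginal.\<close>

lemma weight_step:
  assumes sep: "separated D T" and \<sigma>: "\<sigma> \<in> partial_assignments \<Phi>"
    and u: "u \<in> vars \<Phi>" "\<sigma> u = Unacc" and \<beta>: "0 \<le> \<beta>" "\<beta> \<le> 1" "\<beta> \<le> star_bound"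
  shows "\<beta> * weight D T (\<sigma>(u := Star)) + (1 - \<beta>) * (\<Sum>x\<in>Dom \<Phi> u. weight D T (\<sigma>(u := Val x)))
           \<le> weight D T \<sigma>"
proof -
  have una: "u \<notin> assigned \<Phi> \<sigma>" using u by (auto simp: assigned_def)
  have fin: "finite T" using sep finite_subset unfolding separated_def by (metis finite_constraints)
  let ?N = "cnt \<sigma> (all_sat D)"
  show ?thesis
  proof (cases "\<exists>c\<in>T. u \<in> vbl \<Phi> c")
    case False
    then have "(\<Prod>c\<in>T. pot c (\<sigma>(u := Star))) = (\<Prod>c\<in>T. pot c \<sigma>)"
      using una by (intro prod.cong refl pot_Star_outside) auto
    then have 1: "weight D T (\<sigma>(u := Star)) = weight D T \<sigma>"
      using una by (simp add: weight_def cnt_Star)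
    have "(\<Sum>x\<in>Dom \<Phi> u. weight D T (\<sigma>(u := Val x))) =
        (\<Sum>x\<in>Dom \<Phi> u. cnt (\<sigma>(u := Val x)) (all_sat D) * (\<Prod>c\<in>T. pot c \<sigma>))"
      unfolding weight_def using False una u
      by (intro sum.cong refl arg_cong2[where f = times] prod.cong pot_Val_outside) auto
    also have "\<dots> = weight D T \<sigma>"
      using u una by (simp add: weight_def cnt_sum flip: sum_distrib_right)
    finally show ?thesis using 1 by (simp add: algebra_simps)
  next
    case True
    then obtain c where c: "c \<in> T" "u \<in> vbl \<Phi> c" by blast
    let ?R = "\<Prod>d\<in>T - {c}. pot d \<sigma>"
    have cC: "c \<in> C" and out: "\<And>d. d \<in> T - {c} \<Longrightarrow> u \<notin> vbl \<Phi> d" and outD: "\<And>d. d \<in> D \<Longrightarrow> u \<notin> vbl \<Phi> d"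
      using sep c unfolding separated_def pairwise_def by blast+
    have R: "(\<Prod>d\<in>T. pot d \<tau>) = pot c \<tau> * (\<Prod>d\<in>T - {c}. pot d \<tau>)" for \<tau>
      using fin c by (simp add: prod.remove)
    have "(\<Prod>d\<in>T - {c}. pot d (\<sigma>(u := Star))) = ?R"
      using una out by (intro prod.cong refl pot_Star_outside) auto
    then have 1: "weight D T (\<sigma>(u := Star)) = ?N * ((pot c \<sigma> - star_bound + 1) * ?R)"
      using una c cC u by (simp add: weight_def cnt_Star R pot_Star_inside)
    let ?q = "real (dom_size \<Phi> u)"
    have 2: "weight D T (\<sigma>(u := Val x)) = ?N / ?q * ?R * pot c (\<sigma>(u := Val x))" if "x \<in> Dom \<Phi> u" for x
    proof -
      have "(\<Prod>d\<in>T - {c}. pot d (\<sigma>(u := Val x))) = ?R"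
        using una out u that by (intro prod.cong refl pot_Val_outside) auto
      moreover have "cnt (\<sigma>(u := Val x)) (all_sat D) = ?N / ?q"
        using u una that outD by (intro cnt_indep all_sat_fun_upd) auto
      ultimately show ?thesis by (simp add: weight_def R)
    qed
    have "(\<Sum>x\<in>Dom \<Phi> u. weight D T (\<sigma>(u := Val x))) = ?N / ?q * ?R * (\<Sum>x\<in>Dom \<Phi> u. pot c (\<sigma>(u := Val x)))"
      by (simp add: 2 sum_distrib_left)
    also have "\<dots> = ?N * ?R * (pot c \<sigma> - star_bound)"
      using dom_size_ge_2[OF u(1)] pot_Val_inside[OF cC c(2) u(2) \<sigma>] by simp
    finally have "\<beta> * weight D T (\<sigma>(u := Star)) + (1 - \<beta>) * (\<Sum>x\<in>Dom \<Phi> u. weight D T (\<sigma>(u := Val x)))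
        = \<beta> * (?N * ((pot c \<sigma> - star_bound + 1) * ?R)) + (1 - \<beta>) * (?N * ?R * (pot c \<sigma> - star_bound))"
      using 1 by simp
    also have "\<dots> = ?N * ?R * (pot c \<sigma> - star_bound + \<beta>)"
      by (simp add: algebra_simps)
    also have "\<dots> \<le> ?N * ?R * pot c \<sigma>"
      using \<beta> by (intro mult_left_mono mult_nonneg_nonneg cnt_nonneg prod_nonneg) (auto simp: pot_nonneg)
    also have "\<dots> = weight D T \<sigma>" by (simp add: weight_def R)
    finally show ?thesis .
  qed
qed

end

section \<open>Supermartingale bounds for the path and the process\<close>

locale csp_sampler = csp_instance \<Phi> for \<Phi> :: "('v, 'a, 'c) csp" +
  fixes orc :: "'c \<Rightarrow> ('v \<Rightarrow> 'a pval) \<Rightarrow> bool"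
  assumes frozen_orc: "frozen_oracle \<Phi> orc"
begin

definition bad :: "'c \<Rightarrow> ('v \<Rightarrow> 'a pval) \<Rightarrow> bool" where
  "bad c \<sigma> \<longleftrightarrow> c \<in> frozen \<Phi> orc \<sigma> \<or> (\<exists>u\<in>vbl \<Phi> c. \<sigma> u = Star)"

definition ever_bad :: "'c set \<Rightarrow> ('v \<Rightarrow> 'a pval) list set" where
  "ever_bad T = {xs. \<forall>c\<in>T. \<exists>\<sigma>\<in>set xs. bad c \<sigma>}"

text \<open>A single \<open>Star\<close> contributes weight 1. For a frozen constraint the answer
  "yes" excludes a violation probability below \<open>0.99 * p_thr \<Phi>\<close>, the scale used in
  \<open>pot\<close>.\<close>

lemma pot_ge_1:
  assumes "c \<in> C" "\<sigma> \<in> partial_assignments \<Phi>" "bad c \<sigma>"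
  shows "pot c \<sigma> \<ge> 1"
proof (cases "\<exists>u\<in>vbl \<Phi> c. \<sigma> u = Star")
  case True
  then obtain u where u: "u \<in> vbl \<Phi> c" "\<sigma> u = Star" by blast
  have "access_weight (\<sigma> u) \<le> (\<Sum>u\<in>vbl \<Phi> c. access_weight (\<sigma> u))"
    using u assms finite_vbl access_weight_nonneg by (intro member_le_sum) auto
  moreover have "0 \<le> viol_prob_given \<Phi> c \<sigma> / (0.99 * p_thr \<Phi>)"
    using viol_prob_given_nonneg p_thr_pos by simp
  ultimately show ?thesis using u by (simp add: pot_def)
next
  case False
  then have "orc c \<sigma>" using assms by (auto simp: bad_def frozen_def)
  then have "0.99 * p_thr \<Phi> \<le> viol_prob_given \<Phi> c \<sigma>"
    using assms frozen_orc unfolding frozen_oracle_def by (meson not_le)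
  then have "1 \<le> viol_prob_given \<Phi> c \<sigma> / (0.99 * p_thr \<Phi>)" using p_thr_pos by (simp add: field_simps)
  moreover have "0 \<le> (\<Sum>u\<in>vbl \<Phi> c. access_weight (\<sigma> u))"
    by (intro sum_nonneg access_weight_nonneg)
  ultimately show ?thesis by (simp add: pot_def)
qed

lemma fun_upd_partial:
  "\<sigma> \<in> partial_assignments \<Phi> \<Longrightarrow> y \<in> Val ` Dom \<Phi> u \<union> {Star, Unacc} \<Longrightarrow> \<sigma>(u := y) \<in> partial_assignments \<Phi>"
  by (auto simp: partial_assignments_def)

text \<open>Induction on the number of unaccessed variables. Constraints already bad have potential
  at least 1 and leave both the event and the product; for the others \<open>weight_step\<close>
  applies. The count for \<open>C\<close> is compared with the count for \<open>D\<close> only where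
  the path stops with no constraint left.\<close>

lemma prob_Path_ever_bad:
  assumes "separated D T" "\<sigma> \<in> partial_assignments \<Phi>"
  shows "cnt \<sigma> (all_sat C) * measure_pmf.prob (Path \<Phi> orc \<sigma>) (ever_bad T) \<le> weight D T \<sigma>"
  using assms
proof (induction "card {u \<in> vars \<Phi>. \<sigma> u = Unacc}" arbitrary: \<sigma> T rule: less_induct)
  case less
  note sep = less.prems(1) and \<sigma> = less.prems(2)
  have DC: "D \<subseteq> C" and TC: "T \<subseteq> C" using sep by (auto simp: separated_def)
  have fin: "finite T" using TC finite_constraints by (rule finite_subset)
  define T' where "T' = {c \<in> T. \<not> bad c \<sigma>}"
  have "1 * (\<Prod>c\<in>T'. pot c \<sigma>) \<le> (\<Prod>c\<in>T - T'. pot c \<sigma>) * (\<Prod>c\<in>T'. pot c \<sigma>)"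
    using TC \<sigma> by (intro mult_right_mono prod_ge_1 pot_ge_1 prod_nonneg) (auto simp: T'_def pot_nonneg)
  also have "\<dots> = (\<Prod>c\<in>T. pot c \<sigma>)"
    using fin by (intro prod.subset_diff[symmetric]) (auto simp: T'_def)
  finally have W: "weight D T' \<sigma> \<le> weight D T \<sigma>"
    unfolding weight_def by (intro mult_left_mono cnt_nonneg) simp
  have sep': "separated D T'" using sep by (rule separated_subset) (auto simp: T'_def)
  have Cons: "(Cons \<sigma>) -` ever_bad T = ever_bad T'"
    by (auto simp: ever_bad_def T'_def)
  show ?case
  proof (cases "cnt \<sigma> (all_sat C) > 0")
    \<comment> \<open>Without an agreeing solution the marginal carries no meaning, but then the
      left side vanishes.\<close>
    case False
    then have "cnt \<sigma> (all_sat C) = 0" using cnt_nonneg[of \<sigma> "all_sat C"] by linarith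
    then show ?thesis by (simp add: weight_nonneg)
  next
    case pos: True
    show ?thesis
    proof (cases "next_var \<Phi> orc \<sigma>")
      case None
      then have P: "Path \<Phi> orc \<sigma> = return_pmf [\<sigma>]" by (subst Path.simps) simp
      show ?thesis
      proof (cases "T' = {}")
        case True
        have "cnt \<sigma> (all_sat C) * measure_pmf.prob (Path \<Phi> orc \<sigma>) (ever_bad T) \<le> cnt \<sigma> (all_sat C) * 1"
          by (intro mult_left_mono cnt_nonneg) simp
        also have "\<dots> \<le> weight D T' \<sigma>"
          using DC by (auto simp: weight_def True all_sat_def subset_iff intro!: cnt_mono)
        finally show ?thesis using W by linarith
      next
        case False
        then have "[\<sigma>] \<notin> ever_bad T" by (auto simp: ever_bad_def T'_def)
        then have "measure_pmf.prob (Path \<Phi> orc \<sigma>) (ever_bad T) = 0" by (simp add: P)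
        then show ?thesis by (simp add: weight_nonneg)
      qed
    next
      case (Some u)
      note u = next_var_SomeD(1,3)[OF Some]
      have una: "u \<notin> assigned \<Phi> \<sigma>" using u by (auto simp: assigned_def)
      define r where "r = real (dom_size \<Phi> u) * theta \<Phi> u"
      define \<beta> where "\<beta> = (1 - r) / (2 - r)"
      have r: "r \<le> 1" unfolding r_def by (rule dom_size_theta_le_1[OF csp u(1)])
      then have r2: "0 < 2 - r" by simp
      have \<beta>: "0 \<le> \<beta>" "\<beta> \<le> 1" "1 - \<beta> = 1 / (2 - r)" using r r2 by (simp_all add: \<beta>_def field_simps)
      have \<beta>_le: "\<beta> \<le> star_bound" unfolding \<beta>_def r_def by (rule star_prob_le[OF u(1)])
      define f where "f y = measure_pmf.prob (Path \<Phi> orc (\<sigma>(u := y))) (ever_bad T')" for y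
      define N where "N y = cnt (\<sigma>(u := y)) (all_sat C)" for y
      have IH: "N y * f y \<le> weight D T' (\<sigma>(u := y))" if "y \<in> insert Star (Val ` Dom \<Phi> u)" for y
        unfolding f_def N_def
      proof (rule less.hyps[OF _ sep'])
        show "card {w \<in> vars \<Phi>. (\<sigma>(u := y)) w = Unacc} < card {w \<in> vars \<Phi>. \<sigma> w = Unacc}"
          using u that by (intro psubset_card_mono) auto
        show "\<sigma>(u := y) \<in> partial_assignments \<Phi>" using that by (intro fun_upd_partial \<sigma>) auto
      qed
      have S: "set_pmf (step_value \<Phi> \<sigma> u) \<subseteq> insert Star (Val ` Dom \<Phi> u)"
        using set_pmf_marginal[OF u(1) una pos] by (fastforce simp: step_value_def Let_def split: if_splits)
      have "measure_pmf.prob (Path \<Phi> orc \<sigma>) (ever_bad T) = measure_pmf.expectation (step_value \<Phi> \<sigma> u) f"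
        by (subst Path.simps) (simp add: Some prob_bind_pmf Cons f_def[abs_def])
      also have "\<dots> = (\<Sum>y\<in>insert Star (Val ` Dom \<Phi> u). f y * pmf (step_value \<Phi> \<sigma> u) y)"
        using S finite_Dom[OF u(1)] by (intro integral_measure_pmf_real) auto
      also have "\<dots> = f Star * \<beta> + (\<Sum>x\<in>Dom \<Phi> u. f (Val x) * pmf (step_value \<Phi> \<sigma> u) (Val x))"
        using finite_Dom[OF u(1)] pmf_step_value(1)[OF csp u(1)]
        by (subst sum.insert) (auto simp: sum.reindex inj_on_def \<beta>_def r_def)
      \<comment> \<open>The marginal is a ratio of counts and \<open>1 / (2 - r)\<close> is
        \<open>1 - \<beta>\<close>, so multiplying by the count at \<open>\<sigma>\<close> leaves
        the sums that \<open>weight_step\<close> bounds.\<close>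
      also have "(\<Sum>x\<in>Dom \<Phi> u. f (Val x) * pmf (step_value \<Phi> \<sigma> u) (Val x)) =
          (\<Sum>x\<in>Dom \<Phi> u. (1 - \<beta>) * (N (Val x) * f (Val x)) / cnt \<sigma> (all_sat C))"
        using pmf_step_value(2)[OF csp u(1)] pmf_marginal[OF u(1) una pos]
        by (intro sum.cong refl) (simp add: \<beta>(3) r_def N_def mult_ac)
      also have "\<dots> = (1 - \<beta>) * (\<Sum>x\<in>Dom \<Phi> u. N (Val x) * f (Val x)) / cnt \<sigma> (all_sat C)"
        by (simp add: sum_distrib_left sum_divide_distrib)
      finally have "cnt \<sigma> (all_sat C) * measure_pmf.prob (Path \<Phi> orc \<sigma>) (ever_bad T) =
          \<beta> * (N Star * f Star) + (1 - \<beta>) * (\<Sum>x\<in>Dom \<Phi> u. N (Val x) * f (Val x))"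
        using pos cnt_Star[OF una, of "all_sat C"]
        by (simp add: N_def distrib_left)
      also have "\<dots> \<le> \<beta> * weight D T' (\<sigma>(u := Star)) + (1 - \<beta>) * (\<Sum>x\<in>Dom \<Phi> u. weight D T' (\<sigma>(u := Val x)))"
        using \<beta> r2 by (intro add_mono mult_left_mono sum_mono IH) auto
      also have "\<dots> \<le> weight D T' \<sigma>" using sep' \<sigma> u \<beta> \<beta>_le by (intro weight_step) auto
      finally show ?thesis using W by linarith
    qed
  qed
qed

definition run_invariant :: "nat \<Rightarrow> ('v \<Rightarrow> 'a pval) \<Rightarrow> bool" where
  "run_invariant i \<sigma> \<longleftrightarrow> \<sigma> \<in> partial_assignments \<Phi> \<and> (\<forall>j\<in>{i<..num_vars \<Phi>}. \<sigma> (nth_var \<Phi> j) = Unacc)"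

lemma inj_nth_var: "inj_on (nth_var \<Phi>) {1..num_vars \<Phi>}"
  using csp by (simp add: csp_formula_def)

text \<open>Backward induction over the rounds: \<open>F\<close> is replaced by its conditional
  expectation given the previous state, and the bound passes back by \<open>weight_step\<close>.
  States with no agreeing solution satisfy it trivially.\<close>

lemma expectation_X_pmf_le:
  assumes "separated D T" "i \<le> num_vars \<Phi>" "\<And>\<sigma>. 0 \<le> F \<sigma>" "\<And>\<sigma>. F \<sigma> \<le> 1"
    and "\<And>\<sigma>. run_invariant i \<sigma> \<Longrightarrow> cnt \<sigma> (all_sat C) * F \<sigma> \<le> weight D T \<sigma>"
  shows "cnt blank (all_sat C) * measure_pmf.expectation (X_pmf \<Phi> orc i) F \<le> weight D T blank"
  using assms(2-)
proof (induction i arbitrary: F)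
  case 0
  then show ?case by (simp add: run_invariant_def partial_assignments_def)
next
  case (Suc i)
  note F = Suc.prems(2,3)
  define u where "u = nth_var \<Phi> (Suc i)"
  have u: "u \<in> vars \<Phi>" using Suc.prems(1) by (auto simp: u_def vars_def)
  define next_pmf where "next_pmf \<sigma> = (if u \<in> V_fix \<Phi> orc \<sigma> then return_pmf \<sigma>
       else map_pmf (\<lambda>b. \<sigma>(u := Val b)) (marginal \<Phi> \<sigma> u))" for \<sigma>
  define G where "G \<sigma> = measure_pmf.expectation (next_pmf \<sigma>) F" for \<sigma>
  have G0: "0 \<le> G \<sigma>" for \<sigma> unfolding G_def by (intro integral_nonneg_AE) (auto simp: F)
  have "integrable (measure_pmf (next_pmf \<sigma>)) F" for \<sigma>
    by (intro measure_pmf.integrable_const_bound[where B=1]) (auto simp: F)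
  then have G1: "G \<sigma> \<le> 1" for \<sigma> unfolding G_def
    by (intro measure_pmf.integral_le_const) (auto simp: F)
  have "measure_pmf.expectation (X_pmf \<Phi> orc (Suc i)) F = measure_pmf.expectation (X_pmf \<Phi> orc i) G"
    unfolding G_def[abs_def] next_pmf_def u_def by (simp add: expectation_bind_pmf F Let_def)
  moreover have "cnt blank (all_sat C) * measure_pmf.expectation (X_pmf \<Phi> orc i) G \<le> weight D T blank"
  proof (rule Suc.IH)
    fix \<sigma> assume inv: "run_invariant i \<sigma>"
    then have \<sigma>: "\<sigma> \<in> partial_assignments \<Phi>" and un: "\<sigma> u = Unacc"
      using Suc.prems(1) by (auto simp: run_invariant_def u_def)
    have una: "u \<notin> assigned \<Phi> \<sigma>" using un by (auto simp: assigned_def)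
    show "cnt \<sigma> (all_sat C) * G \<sigma> \<le> weight D T \<sigma>"
    proof (cases "u \<in> V_fix \<Phi> orc \<sigma>")
      case True
      then show ?thesis using inv by (auto simp: G_def next_pmf_def run_invariant_def intro!: Suc.prems(4))
    next
      case False
      show ?thesis
      proof (cases "cnt \<sigma> (all_sat C) > 0")
        case zero: False
        then have "cnt \<sigma> (all_sat C) = 0" using cnt_nonneg[of \<sigma> "all_sat C"] by linarith
        then show ?thesis by (simp add: weight_nonneg)
      next
        case pos: True
        let ?N = "cnt \<sigma> (all_sat C)"
        have "G \<sigma> = measure_pmf.expectation (marginal \<Phi> \<sigma> u) (\<lambda>x. F (\<sigma>(u := Val x)))"
          using False by (simp add: G_def next_pmf_def)
        also have "\<dots> = (\<Sum>x\<in>Dom \<Phi> u. F (\<sigma>(u := Val x)) * pmf (marginal \<Phi> \<sigma> u) x)"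
          using set_pmf_marginal[OF u una pos] finite_Dom[OF u] by (intro integral_measure_pmf_real) auto
        also have "?N * \<dots> = (\<Sum>x\<in>Dom \<Phi> u. cnt (\<sigma>(u := Val x)) (all_sat C) * F (\<sigma>(u := Val x)))"
          using pos by (auto simp: sum_distrib_left pmf_marginal[OF u una pos] intro!: sum.cong)
        also have "\<dots> \<le> (\<Sum>x\<in>Dom \<Phi> u. weight D T (\<sigma>(u := Val x)))"
        proof (intro sum_mono Suc.prems(4))
          fix x assume "x \<in> Dom \<Phi> u"
          then have "\<sigma>(u := Val x) \<in> partial_assignments \<Phi>" by (intro fun_upd_partial \<sigma>) auto
          moreover have "nth_var \<Phi> j \<noteq> u" if "j \<in> {Suc i<..num_vars \<Phi>}" for j
            using that inj_onD[OF inj_nth_var, of j "Suc i"] by (auto simp: u_def)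
          ultimately show "run_invariant (Suc i) (\<sigma>(u := Val x))"
            using inv by (auto simp: run_invariant_def)
        qed
        also have "\<dots> \<le> weight D T \<sigma>"
          using weight_step[OF assms(1) \<sigma> u un, of 0] star_bound_nonneg by simp
        finally show ?thesis .
      qed
    qed
  qed (use Suc.prems G0 G1 in auto)
  ultimately show ?case by simp
qed

text \<open>The first \<open>Star\<close> is written with certainty whenever the variable is not
  fixed, beyond what \<open>star_bound\<close> pays for. As this variable lies in no scope of
  \<open>T\<close>, neither the count nor the potentials change.\<close>

lemma prob_X_path_ever_bad_weight:
  assumes sep: "separated D T" and t: "1 \<le> t" "t \<le> num_vars \<Phi>"
    and nt: "\<And>c. c \<in> T \<Longrightarrow> nth_var \<Phi> t \<notin> vbl \<Phi> c"
  shows "cnt blank (all_sat C) * measure_pmf.prob (X_path \<Phi> orc t) (ever_bad T) \<le> weight D T blank"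
proof -
  define u where "u = nth_var \<Phi> t"
  have u: "u \<in> vars \<Phi>" using t by (auto simp: u_def vars_def)
  show ?thesis
    unfolding X_path_def prob_bind_pmf
  proof (rule expectation_X_pmf_le[OF sep])
    fix \<sigma> assume inv: "run_invariant (t - 1) \<sigma>"
    then have \<sigma>: "\<sigma> \<in> partial_assignments \<Phi>" and un: "\<sigma> u = Unacc"
      using t by (auto simp: run_invariant_def u_def)
    have una: "u \<notin> assigned \<Phi> \<sigma>" using un by (auto simp: assigned_def)
    let ?\<sigma> = "path_start \<Phi> orc t \<sigma>"
    have "?\<sigma> \<in> partial_assignments \<Phi>"
      using \<sigma> by (auto simp: path_start_def intro: fun_upd_partial)
    from prob_Path_ever_bad[OF sep this]
    have "cnt ?\<sigma> (all_sat C) * measure_pmf.prob (Path \<Phi> orc ?\<sigma>) (ever_bad T) \<le> weight D T ?\<sigma>" .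
    moreover have "cnt ?\<sigma> Q = cnt \<sigma> Q" for Q
      using una by (simp add: path_start_def cnt_Star flip: u_def)
    moreover have "pot c ?\<sigma> = pot c \<sigma>" if "c \<in> T" for c
      using una nt[OF that] by (simp add: path_start_def pot_Star_outside flip: u_def)
    then have "(\<Prod>c\<in>T. pot c ?\<sigma>) = (\<Prod>c\<in>T. pot c \<sigma>)" by (rule prod.cong[OF refl])
    ultimately show "cnt \<sigma> (all_sat C) * measure_pmf.prob (Path \<Phi> orc ?\<sigma>) (ever_bad T) \<le> weight D T \<sigma>"
      by (simp add: weight_def)
  qed (use t in auto)
qed

end

section \<open>Numerical estimates and the probability of a fixed disjoint family\<close>

locale csp_lll = csp_sampler \<Phi> orc for \<Phi> :: "('v, 'a, 'c) csp" and orc +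
  assumes lll: "8 * exp 1 * viol_prob \<Phi> * real (csp_degree \<Phi>) ^ 3 \<le> 0.99 * p_thr \<Phi>"
begin

text \<open>A crude estimate from \<open>p_thr \<Phi> \<le> 1/72\<close>. It serves the condition of
  the local lemma and the slack in \<open>pot_blank_le\<close>.\<close>

lemma viol_degree_small: "2 * viol_prob \<Phi> * real \<Delta> \<le> 1/100"
proof -
  let ?q = "real (max_dom \<Phi>)" and ?k = "real (csp_width \<Phi>)" and ?D = "real \<Delta>" and ?p = "viol_prob \<Phi>"
  have pos: "?q \<ge> 2" "?k \<ge> 1" "?D \<ge> 1" using max_dom_ge_2 width_pos degree_pos by simp_all
  have "18 * 1\<^sup>2 * 2 ^ 2 * 1 * 1 \<le> 18 * (exp 1)\<^sup>2 * ?q ^ 2 * ?k * ?D ^ 4"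
    using pos by (intro mult_mono power_mono) (auto simp: one_le_power)
  then have p': "p_thr \<Phi> \<le> 1/72" unfolding p_thr_def by (intro divide_left_mono) auto
  have "8 * (5/2) * (?p * ?D) \<le> 8 * exp 1 * (?p * ?D ^ 3)"
    using exp_1_ge pos viol_prob_nonneg self_le_power[of ?D 3] by (intro mult_mono) auto
  also have "\<dots> \<le> 0.99 / 72" using lll p' by (simp add: mult.assoc)
  finally show ?thesis by simp
qed

text \<open>The violation term and the \<open>zeta\<close> part each give at most
  \<open>1 / (8 e \<Delta> ^ 3)\<close>, the remainder comes from \<open>eta\<close>. The factor
  \<open>1 - 2p\<Delta>\<close> is set aside to pay for the dropped constraints.\<close>

lemma pot_blank_le:
  assumes "c \<in> C"
  shows "pot c blank \<le> (1 - 2 * viol_prob \<Phi> * real \<Delta>) / (8 * real \<Delta> ^ 3)"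
proof -
  let ?q = "real (max_dom \<Phi>)" and ?k = "real (csp_width \<Phi>)" and ?D = "real \<Delta>" and ?p = "viol_prob \<Phi>"
  let ?e = "exp 1 :: real"
  have pos: "?q \<ge> 2" "?k \<ge> 1" "?D \<ge> 1" using max_dom_ge_2 width_pos degree_pos by simp_all
  have "viol_prob_given \<Phi> c blank \<le> ?p"
    using cnt_not_sat_le[OF assms] cnt_true_pos[of blank]
    by (simp add: viol_prob_given_eq pos_divide_le_eq partial_assignments_def)
  then have "viol_prob_given \<Phi> c blank / (0.99 * p_thr \<Phi>) \<le> ?p / (0.99 * p_thr \<Phi>)"
    using p_thr_pos by (intro divide_right_mono) auto
  also have "\<dots> \<le> 1 / (8 * ?e * ?D ^ 3)"
    using lll p_thr_pos pos by (simp add: field_simps)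
  finally have 1: "viol_prob_given \<Phi> c blank / (0.99 * p_thr \<Phi>) \<le> 1 / (8 * ?e * ?D ^ 3)" .
  have "(\<Sum>u\<in>vbl \<Phi> c. access_weight (blank u)) = real (card (vbl \<Phi> c)) * star_bound" by simp
  also have "\<dots> \<le> ?k * star_bound"
    using width_ge[OF assms] star_bound_nonneg by (intro mult_right_mono) auto
  also have "\<dots> \<le> ?k * (?q * (90/89 / (18 * ?e * ?q * ?k * ?D ^ 3) + 1 / (8 * ?e * ?q * ?k * ?D ^ 3)))"
    unfolding star_bound_def using eta_bounds pos
    by (intro mult_left_mono add_mono) (auto simp: zeta_def)
  also have "\<dots> = (90/89/18 + 1/8) / (?e * ?D ^ 3)"
    using pos by (simp add: field_simps)
  finally have "pot c blank \<le> 1 / (8 * ?e * ?D ^ 3) + (90/89/18 + 1/8) / (?e * ?D ^ 3)"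
    using 1 by (simp add: pot_def)
  also have "\<dots> = (90/89/18 + 1/4) / ?e / ?D ^ 3"
    using pos by (simp add: field_simps)
  \<comment> \<open>With \<open>e \<ge> 5/2\<close> the coefficient is below 0.1225, while 0.99/8 =
    0.12375.\<close>
  also have "\<dots> \<le> (90/89/18 + 1/4) / (5/2) / ?D ^ 3"
    using pos exp_1_ge by (intro divide_right_mono divide_left_mono) auto
  also have "\<dots> \<le> (1 - 2 * ?p * ?D) / 8 / ?D ^ 3"
    using viol_degree_small pos by (intro divide_right_mono) auto
  finally show ?thesis by simp
qed

text \<open>Dropping the constraints that meet \<open>T\<close> makes \<open>separated\<close> hold;
  the loss of one factor \<open>s\<close> per member of \<open>T\<close> in the local lemma cancels
  against the \<open>s\<close> in each potential.\<close>

lemma prob_ever_bad_le: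
  assumes t: "1 \<le> t" "t \<le> num_vars \<Phi>" and T: "T \<subseteq> C"
    and disj: "pairwise (\<lambda>c d. vbl \<Phi> c \<inter> vbl \<Phi> d = {}) T"
    and nt: "\<And>c. c \<in> T \<Longrightarrow> nth_var \<Phi> t \<notin> vbl \<Phi> c"
  shows "measure_pmf.prob (X_path \<Phi> orc t) (ever_bad T) \<le> (1 / (8 * real \<Delta> ^ 3)) ^ card T"
proof -
  define D where "D = {c \<in> C. vbl \<Phi> c \<inter> (\<Union>d\<in>T. vbl \<Phi> d) = {}}"
  define s where "s = 1 - 2 * viol_prob \<Phi> * real \<Delta>"
  have s: "s > 0" "4 * viol_prob \<Phi> * real \<Delta> \<le> 1" using viol_degree_small by (simp_all add: s_def)
  have "separated D T" using T disj by (auto simp: separated_def D_def)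
  note bound = prob_X_path_ever_bad_weight[OF this t nt]
  let ?P = "measure_pmf.prob (X_path \<Phi> orc t) (ever_bad T)"
  let ?NC = "cnt blank (all_sat C)" and ?ND = "cnt blank (all_sat D)"
  have NC: "?NC > 0" "?ND * s ^ card T \<le> ?NC"
    using local_lemma_ratio[OF s(2) T] by (simp_all add: D_def s_def)
  have "?NC * ?P \<le> ?ND * (\<Prod>c\<in>T. pot c blank)"
    using bound by (simp add: weight_def)
  also have "\<dots> \<le> ?ND * (\<Prod>c\<in>T. s / (8 * real \<Delta> ^ 3))"
    using T pot_blank_le by (intro mult_left_mono cnt_nonneg prod_mono) (auto simp: pot_nonneg s_def)
  also have "\<dots> = (?ND * s ^ card T) * (1 / (8 * real \<Delta> ^ 3)) ^ card T"
    by (simp add: power_divide)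
  also have "\<dots> \<le> ?NC * (1 / (8 * real \<Delta> ^ 3)) ^ card T"
    using NC by (intro mult_right_mono) auto
  finally show ?thesis using NC(1) by simp
qed

end

section \<open>Counting connected sets\<close>

text \<open>
  \<open>traversals R n m st\<close> consists of the sets of vertices met by the depth-first traversals with \<open>n\<close>
  moves, \<open>m\<close> of which push a neighbour of the top of the stack, the others popping it.
\<close>

fun traversals :: "('c \<Rightarrow> 'c set) \<Rightarrow> nat \<Rightarrow> nat \<Rightarrow> 'c list \<Rightarrow> 'c set set" where
  "traversals R 0 0 st = {{}}"
| "traversals R 0 (Suc m) st = {}"
| "traversals R (Suc n) m [] = {}"
| "traversals R (Suc n) 0 (c # st) = traversals R n 0 st"
| "traversals R (Suc n) (Suc m) (c # st) =
     traversals R n (Suc m) st \<union> (\<Union>d\<in>R c. insert d ` traversals R n m (d # c # st))"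

text \<open>The pushes occupy \<open>m\<close> of \<open>n\<close> positions and each has at most
  \<open>D\<close> targets; the induction step is Pascal's rule.\<close>

lemma card_traversals:
  assumes R: "\<And>c. finite (R c)" "\<And>c. card (R c) \<le> D"
  shows "finite (traversals R n m st) \<and> card (traversals R n m st) \<le> (n choose m) * D ^ m"
  using R
proof (induction R n m st rule: traversals.induct)
  case (5 R n m c st)
  note IH = 5(1)[OF 5(3,4)] 5(2)[OF _ 5(3,4)]
  let ?push = "\<lambda>d. insert d ` traversals R n m (d # c # st)"
  have fin: "finite (?push d)" if "d \<in> R c" for d using IH(2)[OF that] by simp
  have "card (\<Union>d\<in>R c. ?push d) \<le> (\<Sum>d\<in>R c. card (?push d))"
    by (rule card_UN_le) (rule 5(3))
  also have "\<dots> \<le> (\<Sum>d\<in>R c. (n choose m) * D ^ m)"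
    using IH(2) by (intro sum_mono order_trans[OF card_image_le]) auto
  also have "\<dots> \<le> D * ((n choose m) * D ^ m)" using 5(4) by simp
  finally have "card (\<Union>d\<in>R c. ?push d) \<le> (n choose m) * D ^ Suc m" by (simp add: mult_ac)
  moreover have "card (traversals R n (Suc m) st \<union> (\<Union>d\<in>R c. ?push d)) \<le>
      card (traversals R n (Suc m) st) + card (\<Union>d\<in>R c. ?push d)"
    by (rule card_Un_le)
  ultimately have "card (traversals R (Suc n) (Suc m) (c # st)) \<le>
      (n choose Suc m) * D ^ Suc m + (n choose m) * D ^ Suc m"
    using IH(1) by (simp del: power_Suc)
  then show ?case using IH(1) fin 5(3) by (simp add: algebra_simps)
qed auto

text \<open>\<open>t\<close> is on top of the stack when it is pushed, or at the start. Pushing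
  \<open>d\<close> at that moment and popping it at once adds two moves and leaves the rest of the
  traversal as it was.\<close>

lemma traversals_insert:
  assumes "T \<in> traversals R n m st" "t \<in> T \<or> (\<exists>st'. st = t # st')" "d \<in> R t"
  shows "insert d T \<in> traversals R (Suc (Suc n)) (Suc m) st"
  using assms
proof (induction R n m st arbitrary: T rule: traversals.induct)
  case (4 R n c st)
  show ?case
  proof (cases "t = c")
    case True
    then show ?thesis using 4 by auto
  next
    case False
    then show ?thesis using 4 by (cases st) (auto simp: image_iff)
  qed
next
  case (5 R n m c st)
  show ?case
  proof (cases "t = c")
    case True
    then show ?thesis using 5(3,5) by auto
  next
    case False
    then have t: "t \<in> T" using 5(4) by auto
    from 5(3) consider "T \<in> traversals R n (Suc m) st"
      | e T' where "e \<in> R c" "T = insert e T'" "T' \<in> traversals R n m (e # c # st)"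
      by auto
    then show ?thesis
    proof cases
      case 1
      then show ?thesis using 5(1)[OF 1 disjI1[OF t] 5(5)] by simp
    next
      case (2 e T')
      have "insert d T' \<in> traversals R (Suc (Suc n)) (Suc m) (e # c # st)"
        using 2 t by (intro 5(2) 5(5)) auto
      then have "insert e (insert d T') \<in> traversals R (Suc (Suc (Suc n))) (Suc (Suc m)) (c # st)"
        using 2(1) by (subst traversals.simps) blast
      then show ?thesis using 2 by (simp add: insert_commute)
    qed
  qed
qed auto

section \<open>Bad constraints along a path\<close>

context csp_sampler
begin

definition fix_adj :: "('v \<Rightarrow> 'a pval) \<Rightarrow> ('v \<times> 'v) set" where
  "fix_adj \<sigma> = {(a, b). \<exists>e\<in>{e \<in> hyperedges \<Phi> \<sigma>. e \<subseteq> V_un \<Phi> \<sigma> \<inter> V_fix \<Phi> orc \<sigma>}. a \<in> e \<and> b \<in> e}"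

text \<open>Components are reachability classes; since \<open>fix_adj\<close> is symmetric, the
  representative of a class can be exchanged for a vertex carrying \<open>Star\<close>.\<close>

lemma V_star_iff:
  "a \<in> V_star \<Phi> orc \<sigma> \<longleftrightarrow> a \<in> V_un \<Phi> \<sigma> \<inter> V_fix \<Phi> orc \<sigma> \<and>
     (\<exists>v\<in>V_un \<Phi> \<sigma> \<inter> V_fix \<Phi> orc \<sigma>. \<sigma> v = Star \<and> (v, a) \<in> (fix_adj \<sigma>)\<^sup>*)"
proof -
  let ?W = "V_un \<Phi> \<sigma> \<inter> V_fix \<Phi> orc \<sigma>"
  have "sym ((fix_adj \<sigma>)\<^sup>*)" by (intro sym_rtrancl) (auto simp: sym_def fix_adj_def)
  then have sym: "(x, y) \<in> (fix_adj \<sigma>)\<^sup>* \<Longrightarrow> (y, x) \<in> (fix_adj \<sigma>)\<^sup>*" for x y by (auto dest: symD)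
  have V: "V_star \<Phi> orc \<sigma> = \<Union>{K \<in> ?W // {(x, y) \<in> ?W \<times> ?W. (x, y) \<in> (fix_adj \<sigma>)\<^sup>*}. \<exists>u\<in>K. \<sigma> u = Star}"
    by (simp add: V_star_def hyper_components_def Let_def fix_adj_def)
  show ?thesis
  proof
    assume "a \<in> V_star \<Phi> orc \<sigma>"
    then obtain x v where *: "a \<in> ?W" "v \<in> ?W" "\<sigma> v = Star"
        "(x, a) \<in> (fix_adj \<sigma>)\<^sup>*" "(x, v) \<in> (fix_adj \<sigma>)\<^sup>*"
      unfolding V quotient_def by auto
    have "(v, a) \<in> (fix_adj \<sigma>)\<^sup>*" by (rule rtrancl_trans[OF sym[OF *(5)] *(4)])
    then show "a \<in> ?W \<and> (\<exists>v\<in>?W. \<sigma> v = Star \<and> (v, a) \<in> (fix_adj \<sigma>)\<^sup>*)"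
      using *(1-3) by blast
  next
    assume "a \<in> ?W \<and> (\<exists>v\<in>?W. \<sigma> v = Star \<and> (v, a) \<in> (fix_adj \<sigma>)\<^sup>*)"
    then show "a \<in> V_star \<Phi> orc \<sigma>"
      unfolding V quotient_def by auto
  qed
qed

lemma Star_in_V_star: "u \<in> vars \<Phi> \<Longrightarrow> \<sigma> u = Star \<Longrightarrow> u \<in> V_star \<Phi> orc \<sigma>"
  by (auto simp: V_star_iff V_un_def assigned_def V_fix_def accessed_def)

lemma hyperedgesE:
  assumes "e \<in> hyperedges \<Phi> \<sigma>"
  obtains d where "d \<in> C" "e \<subseteq> vbl \<Phi> d"
  using assms by (auto simp: hyperedges_def)

text \<open>An unassigned fixed variable either carries \<open>Star\<close>, and then
  \<open>d\<close> itself is bad, or is unaccessed and lies in a frozen constraint.\<close>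

lemma V_star_bad:
  assumes "a \<in> V_star \<Phi> orc \<sigma>" "d \<in> C" "a \<in> vbl \<Phi> d"
  obtains b where "b \<in> C" "bad b \<sigma>" "a \<in> vbl \<Phi> b"
proof -
  have a: "a \<in> vars \<Phi>" "\<sigma> a \<notin> range Val" "a \<in> V_fix \<Phi> orc \<sigma>"
    using assms(1) by (auto simp: V_star_iff V_un_def assigned_def)
  show thesis
  proof (cases "\<sigma> a = Star")
    case True
    then show thesis using assms by (intro that[of d]) (auto simp: bad_def)
  next
    case False
    then have "\<sigma> a = Unacc" using a by (cases "\<sigma> a") auto
    then obtain c where "c \<in> frozen \<Phi> orc \<sigma>" "a \<in> vbl \<Phi> c"
      using a by (auto simp: V_fix_def accessed_def)
    then show thesis by (intro that[of c]) (auto simp: bad_def frozen_def)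
  qed
qed

text \<open>Frozen constraints away from every \<open>Star\<close> are left out: only those touching
  \<open>V_star\<close> are linked to each other.\<close>

definition bad_at :: "('v \<Rightarrow> 'a pval) \<Rightarrow> 'c set" where
  "bad_at \<sigma> = {c \<in> C. bad c \<sigma> \<and> vbl \<Phi> c \<inter> V_star \<Phi> orc \<sigma> \<noteq> {}}"

lemma bad_atI: "c \<in> C \<Longrightarrow> bad c \<sigma> \<Longrightarrow> a \<in> vbl \<Phi> c \<Longrightarrow> a \<in> V_star \<Phi> orc \<sigma> \<Longrightarrow> c \<in> bad_at \<sigma>"
  by (auto simp: bad_at_def)

lemma nbrsI: "c \<in> C \<Longrightarrow> a \<in> vbl \<Phi> b \<Longrightarrow> a \<in> vbl \<Phi> c \<Longrightarrow> c \<in> nbrs b"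
  by (auto simp: nbrs_def)

text \<open>Consecutive vertices of a path in a component share a constraint, so bad constraints containing them
  are at distance at most two.\<close>

lemma bad_at_subset:
  assumes star: "\<And>v c. \<sigma> v = Star \<Longrightarrow> c \<in> C \<Longrightarrow> v \<in> vbl \<Phi> c \<Longrightarrow> c \<in> K"
    and closed: "\<And>b c d. b \<in> K \<Longrightarrow> d \<in> nbrs b \<Longrightarrow> c \<in> nbrs d \<Longrightarrow> c \<in> bad_at \<sigma> \<Longrightarrow> c \<in> K"
  shows "bad_at \<sigma> \<subseteq> K"
proof
  fix c assume c: "c \<in> bad_at \<sigma>"
  let ?W = "V_un \<Phi> \<sigma> \<inter> V_fix \<Phi> orc \<sigma>"
  from c obtain a where a: "a \<in> vbl \<Phi> c" "a \<in> V_star \<Phi> orc \<sigma>" "c \<in> C" "bad c \<sigma>"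
    by (auto simp: bad_at_def)
  then obtain v where v: "v \<in> ?W" "\<sigma> v = Star" "(v, a) \<in> (fix_adj \<sigma>)\<^sup>*"
    by (auto simp: V_star_iff)
  \<comment> \<open>The claim covers every bad constraint at the current vertex, so whichever one
    \<open>V_star_bad\<close> returns is known to lie in \<open>K\<close>.\<close>
  from v(3) have "a \<in> V_star \<Phi> orc \<sigma> \<and> (\<forall>c\<in>C. bad c \<sigma> \<longrightarrow> a \<in> vbl \<Phi> c \<longrightarrow> c \<in> K)"
  proof (induction rule: rtrancl_induct)
    case base
    then show ?case using v star Star_in_V_star by (auto simp: V_un_def)
  next
    case (step a a')
    from step(2) obtain e where e: "e \<in> hyperedges \<Phi> \<sigma>" "e \<subseteq> ?W" "a \<in> e" "a' \<in> e"
      by (auto simp: fix_adj_def)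
    obtain d where d: "d \<in> C" "e \<subseteq> vbl \<Phi> d" using e(1) by (rule hyperedgesE)
    have a': "a' \<in> V_star \<Phi> orc \<sigma>"
      using v e rtrancl_into_rtrancl[OF step(1,2)] by (auto simp: V_star_iff)
    obtain b where b: "b \<in> C" "bad b \<sigma>" "a \<in> vbl \<Phi> b"
      using V_star_bad[of a \<sigma> d] step(3) d e by blast
    then have "b \<in> K" using step(3) by blast
    then have "c \<in> K" if "c \<in> C" "bad c \<sigma>" "a' \<in> vbl \<Phi> c" for c
      using that a' b d e by (intro closed[of b d c]) (auto intro: nbrsI bad_atI)
    then show ?case using a' by blast
  qed
  then show "c \<in> K" using a by blast
qed

text \<open>The boundary hyperedge at \<open>u\<close> comes from a constraint \<open>d\<close>
  containing a vertex \<open>a\<close> of \<open>V_star\<close>, and some bad \<open>b\<close>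
  contains \<open>a\<close>. So each newly accessed variable lies in the scope of a neighbour of a
  bad constraint.\<close>

lemma next_var_adjacent:
  assumes "next_var \<Phi> orc \<sigma> = Some u"
  obtains a b d where "b \<in> bad_at \<sigma>" "a \<in> V_star \<Phi> orc \<sigma>" "d \<in> nbrs b" "a \<in> vbl \<Phi> d" "u \<in> vbl \<Phi> d"
proof -
  obtain e a where e: "e \<in> hyperedges \<Phi> \<sigma>" "u \<in> e" "a \<in> e" "a \<in> V_star \<Phi> orc \<sigma>"
    using next_var_SomeD(2)[OF assms] by (auto simp: V_bd_def)
  obtain d where d: "d \<in> C" "e \<subseteq> vbl \<Phi> d" using e(1) by (rule hyperedgesE)
  obtain b where b: "b \<in> C" "bad b \<sigma>" "a \<in> vbl \<Phi> b"
    using V_star_bad[of a \<sigma> d] d e by blast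
  show thesis using b d e by (intro that[of b a d]) (auto intro: bad_atI nbrsI)
qed

section \<open>Deterministic properties of the paths in the support\<close>

definition trajectory :: "('v \<Rightarrow> 'a pval) list \<Rightarrow> bool" where
  "trajectory xs \<longleftrightarrow> xs \<noteq> [] \<and> (\<forall>j. Suc j < length xs \<longrightarrow>
     (\<exists>u y. next_var \<Phi> orc (xs ! j) = Some u \<and> y \<noteq> Unacc \<and> xs ! Suc j = (xs ! j)(u := y)))"

lemma set_pmf_Path:
  "xs \<in> set_pmf (Path \<Phi> orc \<sigma>) \<Longrightarrow> trajectory xs \<and> hd xs = \<sigma> \<and> (next_var \<Phi> orc \<sigma> = None \<longrightarrow> length xs = 1)"
proof (induction "card {u \<in> vars \<Phi>. \<sigma> u = Unacc}" arbitrary: \<sigma> xs rule: less_induct)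
  case less
  show ?case
  proof (cases "next_var \<Phi> orc \<sigma>")
    case None
    then have "xs = [\<sigma>]" using less.prems by (subst (asm) Path.simps) simp
    then show ?thesis by (simp add: trajectory_def)
  next
    case (Some u)
    note u = next_var_SomeD(1,3)[OF Some]
    from less.prems Some obtain y ys where y: "y \<in> set_pmf (step_value \<Phi> \<sigma> u)"
        and ys: "ys \<in> set_pmf (Path \<Phi> orc (\<sigma>(u := y)))" and xs: "xs = \<sigma> # ys"
      by (subst (asm) Path.simps) auto
    have yU: "y \<noteq> Unacc" using y Unacc_notin_step_value by metis
    have "card {w \<in> vars \<Phi>. (\<sigma>(u := y)) w = Unacc} < card {w \<in> vars \<Phi>. \<sigma> w = Unacc}"
      using u yU by (intro psubset_card_mono) auto
    from less.hyps[OF this ys] have IH: "trajectory ys" "hd ys = \<sigma>(u := y)" by auto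
    have "\<exists>u y. next_var \<Phi> orc (xs ! j) = Some u \<and> y \<noteq> Unacc \<and> xs ! Suc j = (xs ! j)(u := y)"
      if "Suc j < length xs" for j
    proof (cases j)
      case 0
      then show ?thesis using IH Some yU by (auto simp: xs trajectory_def hd_conv_nth)
    next
      case (Suc j')
      then show ?thesis using IH(1) that by (auto simp: xs trajectory_def)
    qed
    then show ?thesis using Some by (auto simp: trajectory_def xs)
  qed
qed

definition bad_along :: "('v \<Rightarrow> 'a pval) list \<Rightarrow> 'c set" where
  "bad_along xs = (\<Union>\<sigma>\<in>set xs. bad_at \<sigma>)"

lemma bad_along_subset: "bad_along xs \<subseteq> C"
  by (auto simp: bad_along_def bad_at_def)

lemma bad_along_ever_bad: "T \<subseteq> bad_along xs \<Longrightarrow> xs \<in> ever_bad T"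
  by (force simp: bad_along_def bad_at_def ever_bad_def)

lemma root_in_bad_along:
  assumes "trajectory xs" "hd xs v = Star" "r \<in> C" "v \<in> vbl \<Phi> r"
  shows "r \<in> bad_along xs"
proof -
  have "v \<in> V_star \<Phi> orc (hd xs)" using assms vbl_subset by (intro Star_in_V_star) auto
  then have "r \<in> bad_at (hd xs)" using assms by (intro bad_atI) (auto simp: bad_def)
  then show ?thesis using assms(1) by (auto simp: bad_along_def trajectory_def)
qed

text \<open>Connectedness is expressed by sets \<open>K\<close> closed under double links. A new
  \<open>Star\<close> at \<open>u\<close> lies in a neighbour \<open>d\<close> of an earlier bad
  constraint \<open>b\<close>, so all constraints at \<open>u\<close> are two links from
  \<open>b\<close>; the other occurrences of \<open>Star\<close> are inherited. Then
  \<open>bad_at_subset\<close> settles each state.\<close>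

lemma bad_along_connected:
  assumes tr: "trajectory xs" and hd: "\<And>w. hd xs w = Star \<Longrightarrow> w = v" and root: "hd xs v = Star"
    and r: "r \<in> C" "v \<in> vbl \<Phi> r" "r \<in> K"
    and closed: "\<And>b c d. b \<in> K \<Longrightarrow> d \<in> nbrs b \<Longrightarrow> c \<in> nbrs d \<Longrightarrow> c \<in> bad_along xs \<Longrightarrow> c \<in> K"
  shows "bad_along xs \<subseteq> K"
proof -
  have ne: "xs \<noteq> []" using tr by (simp add: trajectory_def)
  have along: "bad_at (xs ! j) \<subseteq> bad_along xs" if "j < length xs" for j
    using that nth_mem unfolding bad_along_def by blast
  have sub: "bad_at (xs ! j) \<subseteq> K"
    if "j < length xs" "\<And>w c. (xs ! j) w = Star \<Longrightarrow> c \<in> C \<Longrightarrow> w \<in> vbl \<Phi> c \<Longrightarrow> c \<in> K" for j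
  proof (rule bad_at_subset)
    fix b c d assume "b \<in> K" "d \<in> nbrs b" "c \<in> nbrs d" "c \<in> bad_at (xs ! j)"
    then show "c \<in> K" using along[OF that(1)] by (intro closed[of b d c]) auto
  qed (rule that)
  have "\<forall>w c. (xs ! j) w = Star \<longrightarrow> c \<in> C \<longrightarrow> w \<in> vbl \<Phi> c \<longrightarrow> c \<in> K" if "j < length xs" for j
    using that
  proof (induction j)
    case 0
    show ?case
    proof (intro allI impI)
      fix w c assume w: "(xs ! 0) w = Star" and c: "c \<in> C" "w \<in> vbl \<Phi> c"
      have "w = v" using hd w ne by (simp add: hd_conv_nth)
      \<comment> \<open>All constraints at \<open>v\<close> are neighbours of \<open>r\<close>; the
        first of the two links is the loop at \<open>r\<close>.\<close>
      then show "c \<in> K"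
        using c r root_in_bad_along[OF tr root] by (intro closed[of r r c]) (auto intro: nbrsI nbrs_refl)
    qed
  next
    case (Suc j)
    then obtain u y where u: "next_var \<Phi> orc (xs ! j) = Some u" "xs ! Suc j = (xs ! j)(u := y)"
      using tr unfolding trajectory_def by blast
    obtain a b d where abd: "b \<in> bad_at (xs ! j)" "d \<in> nbrs b" "u \<in> vbl \<Phi> d"
      using next_var_adjacent[OF u(1)] by metis
    have IH: "c \<in> K" if "(xs ! j) w = Star" "c \<in> C" "w \<in> vbl \<Phi> c" for w c
      using Suc that by simp
    have bK: "b \<in> K" using sub[of j] Suc.prems IH abd by auto
    show ?case
    proof (intro allI impI)
      fix w c assume w: "(xs ! Suc j) w = Star" and c: "c \<in> C" "w \<in> vbl \<Phi> c"
      show "c \<in> K"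
      proof (cases "w = u")
        case False
        then show ?thesis using w c u(2) by (auto intro: IH)
      next
        case True
        have "w \<in> V_star \<Phi> orc (xs ! Suc j)" using w c vbl_subset by (intro Star_in_V_star) auto
        then have "c \<in> bad_at (xs ! Suc j)" using w c by (intro bad_atI) (auto simp: bad_def)
        then show ?thesis
          using along Suc.prems abd bK c True by (intro closed[of b d c]) (auto intro: nbrsI)
      qed
    qed
  qed
  then have "bad_at (xs ! j) \<subseteq> K" if "j < length xs" for j using that sub by blast
  then show ?thesis unfolding bad_along_def by (metis UN_least in_set_conv_nth)
qed

text \<open>Each step accesses a new variable of \<open>U\<close>, the union of the scopes of the
  neighbours of bad constraints, so the length is bounded by the size of \<open>U\<close>.\<close>

lemma path_length_less:
  assumes tr: "trajectory xs" and root: "hd xs v = Star" and r: "r \<in> C" "v \<in> vbl \<Phi> r"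
  shows "path_length xs < card (bad_along xs) * \<Delta> * csp_width \<Phi>"
proof -
  define U where "U = (\<Union>b\<in>bad_along xs. \<Union>c\<in>nbrs b. vbl \<Phi> c)"
  have finB: "finite (bad_along xs)" using bad_along_subset by (rule finite_subset) simp
  have finU: "finite U" using finB finite_vbl by (auto simp: U_def nbrs_def)
  have ne: "xs \<noteq> []" using tr by (simp add: trajectory_def)
  have "card U \<le> (\<Sum>b\<in>bad_along xs. card (\<Union>c\<in>nbrs b. vbl \<Phi> c))"
    unfolding U_def by (rule card_UN_le[OF finB])
  also have "\<dots> \<le> (\<Sum>b\<in>bad_along xs. \<Delta> * csp_width \<Phi>)"
  proof (rule sum_mono)
    fix b assume b: "b \<in> bad_along xs"
    have "card (\<Union>c\<in>nbrs b. vbl \<Phi> c) \<le> (\<Sum>c\<in>nbrs b. card (vbl \<Phi> c))"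
      by (rule card_UN_le) simp
    also have "\<dots> \<le> (\<Sum>c\<in>nbrs b. csp_width \<Phi>)"
      by (intro sum_mono width_ge) (auto simp: nbrs_def)
    also have "\<dots> \<le> \<Delta> * csp_width \<Phi>"
      using card_nbrs_le[of b] b bad_along_subset by auto
    finally show "card (\<Union>c\<in>nbrs b. vbl \<Phi> c) \<le> \<Delta> * csp_width \<Phi>" .
  qed
  finally have cU: "card U \<le> card (bad_along xs) * \<Delta> * csp_width \<Phi>" by (simp add: mult.assoc)
  define A where "A j = {u \<in> U. (xs ! j) u = Unacc}" for j
  have fA: "finite (A j)" for j using finU by (simp add: A_def)
  have "card (A j) + j \<le> card (A 0)" if "j < length xs" for j
    using that
  proof (induction j)
    case (Suc j)
    then obtain u y where u: "next_var \<Phi> orc (xs ! j) = Some u" "y \<noteq> Unacc" "xs ! Suc j = (xs ! j)(u := y)"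
      using tr unfolding trajectory_def by blast
    obtain b d where "b \<in> bad_at (xs ! j)" "d \<in> nbrs b" "u \<in> vbl \<Phi> d"
      using next_var_adjacent[OF u(1)] by metis
    then have "u \<in> U" using Suc.prems by (force simp: U_def bad_along_def)
    then have "A (Suc j) \<subset> A j" using u next_var_SomeD(3)[OF u(1)] by (auto simp: A_def)
    then have "card (A (Suc j)) < card (A j)" using fA by (intro psubset_card_mono)
    then show ?case using Suc by simp
  qed simp
  from this[of "path_length xs"] have "path_length xs \<le> card (A 0)"
    using ne by (simp add: path_length_def)
  \<comment> \<open>\<open>v\<close> belongs to \<open>U\<close> but is accessed from the start.
    This makes the inequality strict, as the greedy choice requires.\<close>
  also have "v \<in> U" using root_in_bad_along[OF tr root r] r nbrs_refl by (auto simp: U_def)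
  then have "v \<in> U - A 0" using root ne by (simp add: A_def hd_conv_nth)
  then have "A 0 \<subset> U" by (auto simp: A_def)
  then have "card (A 0) < card U" using finU by (intro psubset_card_mono)
  finally show ?thesis using cU by simp
qed

section \<open>Disjoint families of bad constraints\<close>

definition within3 :: "'c \<Rightarrow> 'c set" where
  "within3 c = (if c \<in> C then \<Union>b\<in>nbrs c. \<Union>d\<in>nbrs b. nbrs d else {})"

lemma finite_within3: "finite (within3 c)"
  by (simp add: within3_def)

text \<open>The value \<open>{}\<close> outside \<open>C\<close> makes the bound hold at every
  vertex, as \<open>card_traversals\<close> demands.\<close>

lemma card_within3: "card (within3 c) \<le> \<Delta> ^ 3"
proof (cases "c \<in> C")
  case True
  have UN: "card (\<Union>b\<in>nbrs c. S b) \<le> \<Delta> * m" if "c \<in> C" "\<And>b. b \<in> C \<Longrightarrow> card (S b) \<le> m"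
    for c m and S :: "'c \<Rightarrow> 'c set"
  proof -
    have "card (\<Union>b\<in>nbrs c. S b) \<le> (\<Sum>b\<in>nbrs c. card (S b))" by (rule card_UN_le) simp
    also have "\<dots> \<le> (\<Sum>b\<in>nbrs c. m)" using that by (intro sum_mono) (auto simp: nbrs_def)
    also have "\<dots> \<le> \<Delta> * m" using card_nbrs_le[OF \<open>c \<in> C\<close>] by simp
    finally show ?thesis .
  qed
  have "card (\<Union>b\<in>nbrs c. \<Union>d\<in>nbrs b. nbrs d) \<le> \<Delta> * (\<Delta> * \<Delta>)"
    by (intro UN True card_nbrs_le)
  then show ?thesis using True by (simp add: within3_def power3_eq_cube mult.assoc)
qed (simp add: within3_def)

text \<open>With \<open>i\<close> pushes and \<open>i\<close> pops the traversal returns to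
  \<open>[r]\<close>. The root stays outside \<open>T\<close>: it will contain the initial
  \<open>Star\<close> and be bad for certain, and disjointness from it keeps that variable out of
  the scopes of \<open>T\<close>.\<close>

definition witnesses :: "nat \<Rightarrow> 'c \<Rightarrow> 'c set set" where
  "witnesses i r = {T \<in> traversals within3 (2 * i) i [r]. T \<subseteq> C \<and> card T = i \<and> r \<notin> T \<and>
     pairwise (\<lambda>c d. vbl \<Phi> c \<inter> vbl \<Phi> d = {}) (insert r T)}"

lemma finite_witnesses: "finite (witnesses i r)"
  using card_traversals[of within3, OF finite_within3 card_within3] by (simp add: witnesses_def)

lemma card_witnesses: "card (witnesses i r) \<le> (4 * \<Delta> ^ 3) ^ i"
proof -
  have "card (witnesses i r) \<le> card (traversals within3 (2 * i) i [r])"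
    using card_traversals[of within3, OF finite_within3 card_within3]
    by (intro card_mono) (auto simp: witnesses_def)
  also have "\<dots> \<le> ((2 * i) choose i) * (\<Delta> ^ 3) ^ i"
    using card_traversals[of within3, OF finite_within3 card_within3] by blast
  also have "\<dots> \<le> 2 ^ (2 * i) * (\<Delta> ^ 3) ^ i" by (intro mult_right_mono binomial_le_pow2) simp
  also have "\<dots> = (4 * \<Delta> ^ 3) ^ i" by (simp add: power_mult power_mult_distrib)
  finally show ?thesis .
qed

text \<open>Greedy choice: the next element is taken at distance at most two from the neighbourhood of the previous ones.\<close>

lemma witness_exists:
  assumes B: "B \<subseteq> C" "r \<in> B" and big: "i * \<Delta> < card B"
    and conn: "\<And>K. r \<in> K \<Longrightarrow>
      (\<And>b c d. b \<in> K \<Longrightarrow> d \<in> nbrs b \<Longrightarrow> c \<in> nbrs d \<Longrightarrow> c \<in> B \<Longrightarrow> c \<in> K) \<Longrightarrow> B \<subseteq> K"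
  shows "m \<le> i \<Longrightarrow> \<exists>T\<in>witnesses m r. T \<subseteq> B"
proof (induction m)
  case 0
  then show ?case by (auto simp: witnesses_def)
next
  case (Suc m)
  then obtain T where T: "T \<in> witnesses m r" "T \<subseteq> B" by auto
  let ?X = "insert r T"
  have X: "?X \<subseteq> C" using T B by auto
  have finT: "finite T" using T B finite_constraints by (meson finite_subset)
  have "card (\<Union>t\<in>?X. nbrs t) \<le> (\<Sum>t\<in>?X. card (nbrs t))" using finT by (intro card_UN_le) simp
  also have "\<dots> \<le> (\<Sum>t\<in>?X. \<Delta>)" using X by (intro sum_mono card_nbrs_le) auto
  also have "\<dots> = Suc m * \<Delta>" using finT T by (simp add: witnesses_def)
  also have "\<dots> \<le> i * \<Delta>" using Suc.prems by (intro mult_right_mono) auto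
  finally have "card (\<Union>t\<in>?X. nbrs t) < card B" using big by simp
  then have "\<not> B \<subseteq> (\<Union>t\<in>?X. nbrs t)" using finT card_mono[of "\<Union>t\<in>?X. nbrs t" B] by auto
  moreover have "r \<in> (\<Union>t\<in>?X. nbrs t)" using B nbrs_refl by auto
  \<comment> \<open>The neighbourhood of \<open>?X\<close> contains \<open>r\<close> but not all of
    \<open>B\<close>, so it is not closed under double links; \<open>c\<close> is where closure
    fails.\<close>
  ultimately obtain b c d where bcd: "b \<in> (\<Union>t\<in>?X. nbrs t)" "d \<in> nbrs b" "c \<in> nbrs d" "c \<in> B"
      and c: "c \<notin> (\<Union>t\<in>?X. nbrs t)"
    using conn[of "\<Union>t\<in>?X. nbrs t"] by blast
  then obtain t where t: "t \<in> ?X" "b \<in> nbrs t" by blast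
  \<comment> \<open>The link from \<open>t\<close> to \<open>b\<close> is the third step.\<close>
  have "c \<in> within3 t" using t bcd X by (auto simp: within3_def)
  then have trav: "insert c T \<in> traversals within3 (Suc (Suc (2 * m))) (Suc m) [r]"
    using T t by (intro traversals_insert) (auto simp: witnesses_def)
  have disj: "vbl \<Phi> s \<inter> vbl \<Phi> c = {}" if "s \<in> ?X" for s
    using that c bcd(4) B by (auto simp: nbrs_def)
  have cX: "c \<notin> ?X" using c X nbrs_refl by auto
  have "pairwise (\<lambda>c d. vbl \<Phi> c \<inter> vbl \<Phi> d = {}) (insert c ?X)"
    using T(1) disj by (subst pairwise_insert) (auto simp: witnesses_def Int_commute)
  then have "insert c T \<in> witnesses (Suc m) r"
    using trav T cX finT bcd(4) B by (auto simp: witnesses_def insert_commute)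
  then show ?case using T bcd by blast
qed

lemma set_pmf_X_pmf:
  assumes "\<sigma> \<in> set_pmf (X_pmf \<Phi> orc i)" "i \<le> num_vars \<Phi>"
  shows "(\<forall>w. \<sigma> w \<noteq> Star) \<and> (\<forall>j\<in>{i<..num_vars \<Phi>}. \<sigma> (nth_var \<Phi> j) = Unacc)"
  using assms
proof (induction i arbitrary: \<sigma>)
  case (Suc i)
  have inj: "nth_var \<Phi> j \<noteq> nth_var \<Phi> (Suc i)" if "j \<in> {Suc i<..num_vars \<Phi>}" for j
    using that inj_onD[OF inj_nth_var, of j "Suc i"] by auto
  from Suc.prems obtain \<sigma>' where \<sigma>': "\<sigma>' \<in> set_pmf (X_pmf \<Phi> orc i)"
      "\<sigma> = \<sigma>' \<or> (\<exists>b. \<sigma> = \<sigma>'(nth_var \<Phi> (Suc i) := Val b))"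
    by (auto simp: Let_def split: if_splits)
  have "(\<forall>w. \<sigma>' w \<noteq> Star) \<and> (\<forall>j\<in>{i<..num_vars \<Phi>}. \<sigma>' (nth_var \<Phi> j) = Unacc)"
    using Suc \<sigma>' by simp
  then show ?case using \<sigma>'(2) inj by (auto split: if_splits)
qed simp

text \<open>As \<open>i \<ge> 1\<close>, the path makes a step, so the boundary and hence
  \<open>V_star\<close> are nonempty. This excludes the starts where no \<open>Star\<close> was
  placed or where the starting variable lies in no constraint.\<close>

lemma long_path_witness:
  assumes t: "1 \<le> t" "t \<le> num_vars \<Phi>" and xs: "xs \<in> set_pmf (X_path \<Phi> orc t)"
    and i: "1 \<le> i" and long: "i * csp_width \<Phi> * \<Delta>\<^sup>2 \<le> path_length xs"
  shows "\<exists>r\<in>C. nth_var \<Phi> t \<in> vbl \<Phi> r \<and> (\<exists>T\<in>witnesses i r. xs \<in> ever_bad T)"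
proof -
  define v where "v = nth_var \<Phi> t"
  obtain \<sigma> where \<sigma>: "\<sigma> \<in> set_pmf (X_pmf \<Phi> orc (t - 1))" "xs \<in> set_pmf (Path \<Phi> orc (path_start \<Phi> orc t \<sigma>))"
    using xs by (auto simp: X_path_def)
  let ?\<sigma> = "path_start \<Phi> orc t \<sigma>"
  have no_star: "\<sigma> w \<noteq> Star" for w using set_pmf_X_pmf[OF \<sigma>(1)] t by auto
  have tr: "trajectory xs" "hd xs = ?\<sigma>" and stop: "next_var \<Phi> orc ?\<sigma> = None \<Longrightarrow> length xs = 1"
    using set_pmf_Path[OF \<sigma>(2)] by auto
  have pos: "0 < i * csp_width \<Phi> * \<Delta>\<^sup>2" using i width_pos degree_pos by simp
  then have "length xs \<noteq> 1" using long by (auto simp: path_length_def)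
  then have "next_var \<Phi> orc ?\<sigma> \<noteq> None" using stop by blast
  then obtain u where u: "next_var \<Phi> orc ?\<sigma> = Some u" by blast
  obtain a d where ad: "a \<in> V_star \<Phi> orc ?\<sigma>" "d \<in> C" "a \<in> vbl \<Phi> d"
    by (rule next_var_adjacent[OF u]) (auto simp: nbrs_def)
  then obtain s where s: "?\<sigma> s = Star" "(s, a) \<in> (fix_adj ?\<sigma>)\<^sup>*" by (auto simp: V_star_iff)
  have upd: "?\<sigma> = \<sigma>(v := Star)" using s no_star by (auto simp: path_start_def v_def split: if_splits)
  have star_iff: "?\<sigma> w = Star \<longleftrightarrow> w = v" for w using no_star by (simp add: upd)
  have "s = v" using s star_iff by simp
  have "\<exists>r\<in>C. v \<in> vbl \<Phi> r"
    using s(2)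
  proof (cases rule: converse_rtranclE)
    case base
    then show ?thesis using ad \<open>s = v\<close> by auto
  next
    case (step b)
    then show ?thesis using \<open>s = v\<close> by (auto simp: fix_adj_def elim!: hyperedgesE)
  qed
  then obtain r where r: "r \<in> C" "v \<in> vbl \<Phi> r" by blast
  let ?B = "bad_along xs"
  have "i * \<Delta> * (\<Delta> * csp_width \<Phi>) = i * csp_width \<Phi> * \<Delta>\<^sup>2"
    by (simp add: power2_eq_square mult_ac)
  also note long
  also have "path_length xs < card ?B * \<Delta> * csp_width \<Phi>"
    by (rule path_length_less[OF tr(1) _ r]) (simp add: star_iff tr(2))
  also have "\<dots> = card ?B * (\<Delta> * csp_width \<Phi>)" by (rule mult.assoc)
  finally have "i * \<Delta> < card ?B" unfolding mult_less_cancel2 by blast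
  moreover have "r \<in> ?B" using root_in_bad_along[OF tr(1) _ r] star_iff[of v] tr(2) by simp
  moreover have "?B \<subseteq> K" if "r \<in> K"
    "\<And>b c d. b \<in> K \<Longrightarrow> d \<in> nbrs b \<Longrightarrow> c \<in> nbrs d \<Longrightarrow> c \<in> ?B \<Longrightarrow> c \<in> K" for K
    by (rule bad_along_connected[OF tr(1) _ _ r that]) (use star_iff tr(2) in auto)
  ultimately obtain T where "T \<in> witnesses i r" "T \<subseteq> ?B"
    using witness_exists[OF bad_along_subset] by (metis le_refl)
  then show ?thesis using r bad_along_ever_bad unfolding v_def by blast
qed

end

section \<open>The union bound\<close>

context csp_lll
begin

text \<open>There are at most \<open>\<Delta>\<close> roots and
  \<open>(4 * \<Delta> ^ 3) ^ i\<close> witnesses for each; a witness has probability at most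
  \<open>(1 / (8 * \<Delta> ^ 3)) ^ i\<close>, which leaves \<open>1/2\<close> per element.\<close>

lemma prob_path_length_le:
  assumes t: "1 \<le> t" "t \<le> num_vars \<Phi>" and i: "1 \<le> i"
  shows "measure_pmf.prob (X_path \<Phi> orc t) {xs. i * csp_width \<Phi> * \<Delta>\<^sup>2 \<le> path_length xs}
           \<le> real \<Delta> * 2 powi (- int i)"
proof -
  let ?prob = "measure_pmf.prob (X_path \<Phi> orc t)" and ?v = "nth_var \<Phi> t"
  let ?R = "{r \<in> C. ?v \<in> vbl \<Phi> r}"
  let ?b = "1 / (8 * real \<Delta> ^ 3)"
  \<comment> \<open>All constraints containing \<open>?v\<close> are neighbours of any one of
    them.\<close>
  have cR: "card ?R \<le> \<Delta>"
  proof (cases "?R = {}")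
    case False
    then obtain r where r: "r \<in> C" "?v \<in> vbl \<Phi> r" by blast
    then have "card ?R \<le> card (nbrs r)" by (intro card_mono) (auto intro: nbrsI)
    then show ?thesis using card_nbrs_le[OF r(1)] by simp
  next
    case True
    then show ?thesis by (simp only: card.empty)
  qed
  have "?prob {xs. i * csp_width \<Phi> * \<Delta>\<^sup>2 \<le> path_length xs} =
      ?prob ({xs. i * csp_width \<Phi> * \<Delta>\<^sup>2 \<le> path_length xs} \<inter> set_pmf (X_path \<Phi> orc t))"
    by (rule measure_Int_set_pmf[symmetric])
  also have "\<dots> \<le> ?prob (\<Union>r\<in>?R. \<Union>T\<in>witnesses i r. ever_bad T)"
    by (intro measure_pmf.finite_measure_mono) (auto dest!: long_path_witness[OF t _ i])
  also have "\<dots> \<le> (\<Sum>r\<in>?R. ?prob (\<Union>T\<in>witnesses i r. ever_bad T))"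
    by (intro measure_UNION_le) auto
  also have "\<dots> \<le> (\<Sum>r\<in>?R. real ((4 * \<Delta> ^ 3) ^ i) * ?b ^ i)"
  proof (rule sum_mono)
    fix r assume r: "r \<in> ?R"
    have "?prob (\<Union>T\<in>witnesses i r. ever_bad T) \<le> (\<Sum>T\<in>witnesses i r. ?prob (ever_bad T))"
      by (intro measure_UNION_le finite_witnesses) auto
    also have "\<dots> \<le> (\<Sum>T\<in>witnesses i r. ?b ^ i)"
    proof (rule sum_mono)
      fix T assume T: "T \<in> witnesses i r"
      then have disj: "pairwise (\<lambda>c d. vbl \<Phi> c \<inter> vbl \<Phi> d = {}) (insert r T)" "r \<notin> T"
        "T \<subseteq> C" "card T = i"
        by (auto simp: witnesses_def)
      have "?v \<notin> vbl \<Phi> c" if "c \<in> T" for c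
        using that r disj unfolding pairwise_def by fastforce
      moreover have "pairwise (\<lambda>c d. vbl \<Phi> c \<inter> vbl \<Phi> d = {}) T"
        using disj(1) by (rule pairwise_subset) auto
      ultimately show "?prob (ever_bad T) \<le> ?b ^ i"
        using prob_ever_bad_le[OF t disj(3)] disj(4) by simp
    qed
    also have "\<dots> \<le> real ((4 * \<Delta> ^ 3) ^ i) * ?b ^ i"
      unfolding sum_constant using of_nat_mono[OF card_witnesses] by (intro mult_right_mono) auto
    finally show "?prob (\<Union>T\<in>witnesses i r. ever_bad T) \<le> real ((4 * \<Delta> ^ 3) ^ i) * ?b ^ i" .
  qed
  also have "\<dots> = real (card ?R) * (1/2) ^ i"
  proof -
    have "real ((4 * \<Delta> ^ 3) ^ i) * ?b ^ i = (real (4 * \<Delta> ^ 3) * ?b) ^ i"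
      unfolding of_nat_power power_mult_distrib[of "real (4 * \<Delta> ^ 3)"] ..
    also have "real (4 * \<Delta> ^ 3) * ?b = 1/2" using degree_pos by simp
    finally show ?thesis by (simp only: sum_constant)
  qed
  also have "\<dots> \<le> real \<Delta> * (1/2) ^ i" using cR by (intro mult_right_mono) auto
  also have "(1/2 :: real) ^ i = 2 powi (- int i)"
    by (simp add: power_int_minus power_one_over inverse_eq_divide)
  finally show ?thesis .
qed

end

theorem theorem6p21:
  fixes \<Phi> :: "('v, 'a, 'c) csp"
    and orc :: "'c \<Rightarrow> ('v \<Rightarrow> 'a pval) \<Rightarrow> bool"
    and t i :: nat
  assumes "csp_formula \<Phi>"
    and "frozen_oracle \<Phi> orc"
    and "8 * exp 1 * viol_prob \<Phi> * real (csp_degree \<Phi>) ^ 3 \<le> 0.99 * p_thr \<Phi>"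
    and "1 \<le> t" and "t \<le> num_vars \<Phi>"
  shows "measure_pmf.prob (X_path \<Phi> orc t)
           {xs. path_length xs \<ge> i * csp_width \<Phi> * (csp_degree \<Phi>)\<^sup>2}
         \<le> real (csp_degree \<Phi>) * 2 powi (- int i)"
proof -
  interpret csp_lll \<Phi> orc by unfold_locales (fact assms)+
  show ?thesis
  proof (cases "i = 0")
    \<comment> \<open>For \<open>i = 0\<close> a path without steps is allowed, so there may be no
      witness; the bound is at least 1 because \<open>\<Delta> \<ge> 1\<close>.\<close>
    case True
    have "measure_pmf.prob (X_path \<Phi> orc t)
        {xs. path_length xs \<ge> i * csp_width \<Phi> * (csp_degree \<Phi>)\<^sup>2} \<le> 1" by simp
    also have "\<dots> \<le> real (csp_degree \<Phi>) * 2 powi (- int i)" using degree_pos True by simp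
    finally show ?thesis .
  next
    case False
    then show ?thesis using prob_path_length_le[OF assms(4,5)] by simp
  qed
qed

end
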